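(* The problems U$\exists\forall$-Sat and WDom-Strategy are polynomial-time (many-one) equivalent, i.e., each is polynomial-time many-one reducible to the other.
   Context: $\Vert$ denotes concatenation of bit strings; circuit outputs are compared as binary numbers. U$\exists\forall$-Sat: the input consists of two sets $\mathcal{X}=\{x_1,\dots,x_n\}$ and $\mathcal{Y}=\{y_1,\dots,y_n\}$ of Boolean variables and a Boolean formula $\psi$ over $\mathcal{X}\cup\mathcal{Y}$; the question is whether there is exactly one $x^*\in\{0,1\}^n$ such that for all $y'\in\{0,1\}^n$ we have $\psi(x^*\Vert y')=1$. WDom-Strategy (Weak-Dominant-Strategy): the input is a Boolean circuit $C\colon\{0,1\}^{2n}\to\{0,1\}^n$; the question is whether there exists $x\in\{0,1\}^n$ such that for all $x',y\in\{0,1\}^n$ with $x'\neq x$ there exists $y'\in\{0,1\}^n$ with $C(x\Vert y)\geq C(x'\Vert y)$ and $C(x\Vert y')>C(x'\Vert y')$. *)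

theory Defs
  imports "HOL-Computational_Algebra.Polynomial"
begin

section \<open>Deterministic multi-tape Turing machines\<close>

datatype direction = Move_Left | Stay | Move_Right

text \<open>A tape is two-way infinite: the contents of its cells and the position of the head.\<close>
type_synonym tape = "(int \<Rightarrow> nat) \<times> int"

text \<open>
  The tape symbols are the numbers below \<open>num_symbols\<close>; 0 is the blank, 1 and 2 represent the
  bits 0 and 1. The working states are the numbers below \<open>num_states\<close>, with initial state 0; the
  number \<open>num_states\<close> itself is the halting state. The transition function maps the current state
  and the list of scanned symbols (one per tape) to the next state and, for every tape, the symbol
  to be written and the direction in which the head moves afterwards. Only its (finite)
  restriction to the arguments considered in \<open>tm_wf\<close> matters.
\<close>
record tm =
  num_tapes :: nat
  num_symbols :: nat
  num_states :: nat
  trans_fun :: "nat \<Rightarrow> nat list \<Rightarrow> nat \<times> (nat \<times> direction) list"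

definition tm_wf :: "tm \<Rightarrow> bool" where
  "tm_wf M \<longleftrightarrow> num_tapes M \<ge> 2 \<and> num_symbols M \<ge> 3 \<and>
    (\<forall>q ss. q < num_states M \<and> length ss = num_tapes M \<and> (\<forall>s \<in> set ss. s < num_symbols M) \<longrightarrow>
      (case trans_fun M q ss of (q', acts) \<Rightarrow>
         q' \<le> num_states M \<and> length acts = num_tapes M \<and>
         (\<forall>(s, d) \<in> set acts. s < num_symbols M)))"

fun offset :: "direction \<Rightarrow> int" where
  "offset Move_Left = -1"
| "offset Stay = 0"
| "offset Move_Right = 1"

definition scan :: "tape \<Rightarrow> nat" where
  "scan tp = fst tp (snd tp)"

definition act :: "nat \<times> direction \<Rightarrow> tape \<Rightarrow> tape" where
  "act a tp = ((fst tp)(snd tp := fst a), snd tp + offset (snd a))"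

definition tm_step :: "tm \<Rightarrow> nat \<times> tape list \<Rightarrow> nat \<times> tape list" where
  "tm_step M c =
    (case c of (q, tps) \<Rightarrow>
       if q < num_states M
       then (case trans_fun M q (map scan tps) of (q', acts) \<Rightarrow> (q', map2 act acts tps))
       else (q, tps))"

text \<open>The word occupies the cells 0, 1, 2, \<open>\<dots>\<close>; all other cells are blank.\<close>
definition word_cells :: "bool list \<Rightarrow> int \<Rightarrow> nat" where
  "word_cells w i =
    (if 0 \<le> i \<and> i < int (length w) then (if w ! nat i then 2 else 1) else 0)"

definition tm_start :: "tm \<Rightarrow> bool list \<Rightarrow> nat \<times> tape list" where
  "tm_start M w = (0, (word_cells w, 0) # replicate (num_tapes M - 1) (word_cells [], 0))"

text \<open>
  The input is given on the first tape and the output is read off the second one; the final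
  contents of the other tapes and the final head positions are irrelevant.
\<close>
definition computes_within :: "tm \<Rightarrow> bool list \<Rightarrow> bool list \<Rightarrow> nat \<Rightarrow> bool" where
  "computes_within M v w T \<longleftrightarrow>
    (\<exists>t \<le> T. case (tm_step M ^^ t) (tm_start M v) of (q, tps) \<Rightarrow>
       q = num_states M \<and> fst (tps ! 1) = word_cells w)"


section \<open>Decision problems and polynomial-time many-one reductions\<close>

record 'a decision_problem =
  is_instance :: "'a \<Rightarrow> bool"
  is_yes :: "'a \<Rightarrow> bool"
  encode :: "'a \<Rightarrow> bool list"

text \<open>
  Reductions map instances to instances; the behaviour of the machine on words that do not encode
  an instance is irrelevant.
\<close>
definition poly_time_reducible ::
    "'a decision_problem \<Rightarrow> 'b decision_problem \<Rightarrow> bool" (infix \<open>\<le>\<^sub>p\<close> 50) where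
  "P \<le>\<^sub>p Q \<longleftrightarrow>
    (\<exists>(f :: 'a \<Rightarrow> 'b) (M :: tm) (p :: nat poly). tm_wf M \<and>
       (\<forall>a. is_instance P a \<longrightarrow>
          is_instance Q (f a) \<and> (is_yes P a \<longleftrightarrow> is_yes Q (f a)) \<and>
          computes_within M (encode P a) (encode Q (f a)) (poly p (length (encode P a)))))"

definition poly_time_equivalent ::
    "'a decision_problem \<Rightarrow> 'b decision_problem \<Rightarrow> bool" where
  "poly_time_equivalent P Q \<longleftrightarrow> P \<le>\<^sub>p Q \<and> Q \<le>\<^sub>p P"

text \<open>
  Instances are first written as sequences of numbers, which are then encoded in (self-delimiting)
  unary. All numbers that occur in instances of the two problems below (numbers of variables,
  indices of variables and wires) are bounded by the number of objects the instance lists, so that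
  this is polynomially equivalent to writing them in binary.
\<close>
definition encode_nats :: "nat list \<Rightarrow> bool list" where
  "encode_nats ks = concat (map (\<lambda>k. replicate k True @ [False]) ks)"


section \<open>Boolean formulas\<close>

datatype formula =
  FConst bool
| FVar nat
| FNot formula
| FAnd formula formula
| FOr formula formula

fun formula_vars :: "formula \<Rightarrow> nat set" where
  "formula_vars (FConst b) = {}"
| "formula_vars (FVar i) = {i}"
| "formula_vars (FNot \<phi>) = formula_vars \<phi>"
| "formula_vars (FAnd \<phi> \<psi>) = formula_vars \<phi> \<union> formula_vars \<psi>"
| "formula_vars (FOr \<phi> \<psi>) = formula_vars \<phi> \<union> formula_vars \<psi>"

text \<open>The assignment is a bit string: variable \<open>i\<close> has the value of its \<open>i\<close>-th bit.\<close>
fun formula_eval :: "formula \<Rightarrow> bool list \<Rightarrow> bool" where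
  "formula_eval (FConst b) z = b"
| "formula_eval (FVar i) z = z ! i"
| "formula_eval (FNot \<phi>) z = (\<not> formula_eval \<phi> z)"
| "formula_eval (FAnd \<phi> \<psi>) z = (formula_eval \<phi> z \<and> formula_eval \<psi> z)"
| "formula_eval (FOr \<phi> \<psi>) z = (formula_eval \<phi> z \<or> formula_eval \<psi> z)"

text \<open>Reverse Polish notation.\<close>
fun formula_tokens :: "formula \<Rightarrow> nat list" where
  "formula_tokens (FConst b) = [of_bool b]"
| "formula_tokens (FVar i) = [2, i]"
| "formula_tokens (FNot \<phi>) = formula_tokens \<phi> @ [3]"
| "formula_tokens (FAnd \<phi> \<psi>) = formula_tokens \<phi> @ formula_tokens \<psi> @ [4]"
| "formula_tokens (FOr \<phi> \<psi>) = formula_tokens \<phi> @ formula_tokens \<psi> @ [5]"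


section \<open>Boolean circuits\<close>

text \<open>
  The gates of a circuit are listed in topological order. In a circuit with \<open>m\<close> inputs, wire \<open>i\<close>
  is the \<open>i\<close>-th input if \<open>i < m\<close>, and wire \<open>m + j\<close> is the output of the \<open>j\<close>-th gate.
  The arguments of a gate are the wires that it reads.
\<close>
datatype gate =
  GConst bool
| GNot nat
| GAnd nat nat
| GOr nat nat

record circuit =
  gates :: "gate list"
  outputs :: "nat list"

fun gate_wires :: "gate \<Rightarrow> nat set" where
  "gate_wires (GConst b) = {}"
| "gate_wires (GNot i) = {i}"
| "gate_wires (GAnd i j) = {i, j}"
| "gate_wires (GOr i j) = {i, j}"

definition is_circuit :: "nat \<Rightarrow> nat \<Rightarrow> circuit \<Rightarrow> bool" where
  "is_circuit m k C \<longleftrightarrow>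
    (\<forall>j < length (gates C). \<forall>i \<in> gate_wires (gates C ! j). i < m + j) \<and>
    length (outputs C) = k \<and> (\<forall>i \<in> set (outputs C). i < m + length (gates C))"

fun gate_eval :: "bool list \<Rightarrow> gate \<Rightarrow> bool" where
  "gate_eval ws (GConst b) = b"
| "gate_eval ws (GNot i) = (\<not> ws ! i)"
| "gate_eval ws (GAnd i j) = (ws ! i \<and> ws ! j)"
| "gate_eval ws (GOr i j) = (ws ! i \<or> ws ! j)"

definition circuit_eval :: "circuit \<Rightarrow> bool list \<Rightarrow> bool list" where
  "circuit_eval C z =
    (let ws = foldl (\<lambda>ws g. ws @ [gate_eval ws g]) z (gates C)
     in map (\<lambda>i. ws ! i) (outputs C))"

fun gate_tokens :: "gate \<Rightarrow> nat list" where
  "gate_tokens (GConst b) = [of_bool b]"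
| "gate_tokens (GNot i) = [2, i]"
| "gate_tokens (GAnd i j) = [3, i, j]"
| "gate_tokens (GOr i j) = [4, i, j]"

text \<open>The number 5, which does not start a gate, marks the end of the list of gates.\<close>
definition circuit_tokens :: "circuit \<Rightarrow> nat list" where
  "circuit_tokens C = concat (map gate_tokens (gates C)) @ [5] @ outputs C"


section \<open>The two problems\<close>

definition bit_strings :: "nat \<Rightarrow> bool list set" where
  "bit_strings n = {x. length x = n}"

text \<open>The first bit is the most significant one.\<close>
definition binary_value :: "bool list \<Rightarrow> nat" where
  "binary_value z = horner_sum of_bool 2 (rev z)"

text \<open>
  An instance consists of \<open>n\<close> and a formula. Under the concatenation of \<open>x\<close> and \<open>y\<close>, the variables
  with indices \<open>0, \<dots>, n - 1\<close> are those of \<open>\<X>\<close> and the ones with indices \<open>n, \<dots>, 2 * n - 1\<close>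
  are those of \<open>\<Y>\<close>.
\<close>
definition UEA_Sat :: "(nat \<times> formula) decision_problem" where
  "UEA_Sat =
    \<lparr> is_instance = (\<lambda>(n, \<psi>). formula_vars \<psi> \<subseteq> {..<2 * n}),
      is_yes = (\<lambda>(n, \<psi>).
        \<exists>!x. x \<in> bit_strings n \<and> (\<forall>y' \<in> bit_strings n. formula_eval \<psi> (x @ y'))),
      encode = (\<lambda>(n, \<psi>). encode_nats (n # formula_tokens \<psi>)) \<rparr>"

definition WDom_Strategy :: "(nat \<times> circuit) decision_problem" where
  "WDom_Strategy =
    \<lparr> is_instance = (\<lambda>(n, C). is_circuit (2 * n) n C),
      is_yes = (\<lambda>(n, C).
        let val = (\<lambda>z. binary_value (circuit_eval C z)) in
        \<exists>x \<in> bit_strings n. \<forall>x' \<in> bit_strings n. \<forall>y \<in> bit_strings n. x' \<noteq> x \<longrightarrow>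
          (\<exists>y' \<in> bit_strings n. val (x @ y) \<ge> val (x' @ y) \<and> val (x @ y') > val (x' @ y'))),
      encode = (\<lambda>(n, C). encode_nats (n # circuit_tokens C)) \<rparr>"

end

theory Submission
  imports Defs
begin

text \<open>
  A strategy \<open>x\<close> is weakly dominant iff it is the only one whose payoff is nowhere exceeded: two
  such strategies have the same payoffs everywhere, and any other strategy differs from \<open>x\<close> somewhere.
  So both problems ask for a unique \<open>x\<close> with a universal property.

  Given \<open>\<psi>\<close>, the circuit plays \<open>\<psi>\<close> and has additional strategies of which, for every \<open>y\<close>, one wins,
  but none wins for all \<open>y\<close>; then exactly the strategies satisfying \<open>\<forall>y. \<psi>\<close> are nowhere exceeded.
  Given a circuit, the formula says that, if the universally quantified variables are the wires of two
  correct evaluations of the circuit, at \<open>x @ y\<close> and at \<open>x' @ y\<close>, then the first output is at least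
  the second, and forces the superfluous variables of \<open>x\<close> to be false.

  The formula is in reverse Polish notation and the gates are in topological order, so both
  translations proceed from left to right and only need stacks and unary counters. They are written
  in a while language over stacks of bits, each tape except the output tape being one stack.
\<close>

section \<open>Stack programs and their compilation\<close>

text \<open>Both reductions have to preserve uniqueness, so no auxiliary variable may give
  \<open>x\<close> additional freedom. The wires of a circuit depend on \<open>y\<close> and on the
  competitor and cannot be chosen along with \<open>x\<close>; but for given inputs the gate
  equations have exactly one solution, so quantifying over it universally behind an implication
  means the same as quantifying existentially.

  The machines must produce the encodings bit for bit, and a number can be printed only if it is
  known by then. This explains choices that look arbitrary: the number of variables is twice the
  input length rather than the number of wires, the two copies of the wires are interleaved, the
  long conjunction and the long disjunction nest to the left, and gates list their right operand
  first.\<close>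

datatype prog =
  Push nat bool
| Pop nat
| Emit bool
| Seq prog prog (infixr \<open>;;\<close> 60)
| IfTop nat "nat \<Rightarrow> bool" prog prog
| WhileTop nat "nat \<Rightarrow> bool" prog

text \<open>The halting state \<open>states p\<close> is not counted. \<open>Push\<close> takes two
  steps because a machine writes before it moves and the head has to leave the old top first;
  \<open>Pop\<close> and \<open>Emit\<close> write at the current position.\<close>

fun states :: "prog \<Rightarrow> nat" where
  "states (Push i b) = 2"
| "states (Pop i) = 1"
| "states (Emit b) = 1"
| "states (Seq p q) = states p + states q"
| "states (IfTop i c p q) = Suc (states p + states q)"
| "states (WhileTop i c p) = Suc (states p)"

text \<open>\<open>Emit\<close> counts one register so that every program has the input tape and,
  with the output tape, at least two tapes.\<close>

fun regs :: "prog \<Rightarrow> nat" where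
  "regs (Push i b) = Suc i"
| "regs (Pop i) = Suc i"
| "regs (Emit b) = 1"
| "regs (Seq p q) = max (regs p) (regs q)"
| "regs (IfTop i c p q) = max (Suc i) (max (regs p) (regs q))"
| "regs (WhileTop i c p) = max (Suc i) (regs p)"

text \<open>Register 0 is the input tape; tape 1 is reserved for the output, which shifts the other
  registers by one.\<close>

definition tape_of :: "nat \<Rightarrow> nat" where
  "tape_of i = (if i = 0 then 0 else Suc i)"

definition pop_dir :: "nat \<Rightarrow> direction" where
  "pop_dir i = (if i = 0 then Move_Right else Move_Left)"

definition push_dir :: "nat \<Rightarrow> direction" where
  "push_dir i = (if i = 0 then Move_Left else Move_Right)"

definition bit_symbol :: "bool \<Rightarrow> nat" where
  "bit_symbol b = (if b then 2 else 1)"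

definition keep :: "nat list \<Rightarrow> (nat \<times> direction) list" where
  "keep ss = map (\<lambda>s. (s, Stay)) ss"

text \<open>In a sequence the halting number of \<open>p1\<close> already is the initial state of
  \<open>p2\<close>. In a conditional it would likewise fall into the second branch, so it is
  redirected to the common end; in a loop it is redirected to the test.\<close>

fun delta :: "prog \<Rightarrow> nat \<Rightarrow> nat list \<Rightarrow> nat \<times> (nat \<times> direction) list" where
  "delta (Push i b) q ss =
    (if q = 0 then (1, (keep ss)[tape_of i := (ss ! tape_of i, push_dir i)])
     else (2, (keep ss)[tape_of i := (bit_symbol b, Stay)]))"
| "delta (Pop i) q ss = (1, (keep ss)[tape_of i := (0, pop_dir i)])"
| "delta (Emit b) q ss = (1, (keep ss)[1 := (bit_symbol b, Move_Right)])"
| "delta (Seq p1 p2) q ss =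
    (if q < states p1 then delta p1 q ss
     else apfst ((+) (states p1)) (delta p2 (q - states p1) ss))"
| "delta (IfTop i c p1 p2) q ss =
    (if q = 0 then (if c (ss ! tape_of i) then 1 else Suc (states p1), keep ss)
     else if q \<le> states p1
     then apfst (\<lambda>q'. if q' = states p1 then Suc (states p1 + states p2) else Suc q')
            (delta p1 (q - 1) ss)
     else apfst (\<lambda>q'. Suc (states p1 + q')) (delta p2 (q - Suc (states p1)) ss))"
| "delta (WhileTop i c p) q ss =
    (if q = 0 then (if c (ss ! tape_of i) then 1 else Suc (states p), keep ss)
     else apfst (\<lambda>q'. if q' = states p then 0 else Suc q') (delta p (q - 1) ss))"

definition compile :: "prog \<Rightarrow> tm" where
  "compile p = \<lparr>num_tapes = Suc (regs p), num_symbols = 3, num_states = states p,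
     trans_fun = delta p\<rparr>"

lemma states_pos [simp]: "states p > 0"
  by (induction p) auto

lemma regs_pos: "regs p > 0"
  by (induction p) auto

lemma length_keep [simp]: "length (keep ss) = length ss"
  by (simp add: keep_def)

lemma keep_symbols: "\<forall>s \<in> set ss. s < 3 \<Longrightarrow> (s, d) \<in> set (keep ss) \<Longrightarrow> s < 3"
  by (auto simp: keep_def)

lemma keep_update_symbols:
  "\<forall>s \<in> set ss. s < 3 \<Longrightarrow> a < 3 \<Longrightarrow> (s, d) \<in> set ((keep ss)[j := (a, e)]) \<Longrightarrow> s < 3"
  using set_update_subset_insert[of "keep ss" j "(a, e)"] keep_symbols by fastforce

lemma delta_wf:
  assumes "q < states p" "regs p < length ss" "\<forall>s \<in> set ss. s < 3"
  shows "case delta p q ss of (q', acts) \<Rightarrow>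
    q' \<le> states p \<and> length acts = length ss \<and> (\<forall>(s, d) \<in> set acts. s < 3)"
  using assms
proof (induction p arbitrary: q)
  case (Push i b)
  have "tape_of i < length ss" using Push by (auto simp: tape_of_def)
  then have "ss ! tape_of i < 3" using Push by simp
  moreover have "bit_symbol b < 3" by (simp add: bit_symbol_def)
  ultimately show ?case using Push
    by (cases "q = 0") (auto intro: keep_update_symbols)
next
  case (Pop i)
  then show ?case by (auto intro: keep_update_symbols[of ss 0])
next
  case (Emit b)
  moreover have "bit_symbol b < 3" by (simp add: bit_symbol_def)
  ultimately show ?case by (auto intro: keep_update_symbols)
next
  case (Seq p1 p2)
  show ?case
  proof (cases "q < states p1")
    case True
    then show ?thesis using Seq.IH(1)[of q] Seq.prems by (auto split: prod.splits)
  next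
    case False
    then have "q - states p1 < states p2" using Seq.prems by simp
    then show ?thesis using Seq.IH(2)[of "q - states p1"] Seq.prems False
      by (auto split: prod.splits simp: apfst_def map_prod_def)
  qed
next
  case (IfTop i c p1 p2)
  consider "q = 0" | "q \<noteq> 0" "q \<le> states p1" | "q > states p1" by linarith
  then show ?case
  proof cases
    case 1
    then show ?thesis using IfTop.prems keep_symbols by auto
  next
    case 2
    then have "q - 1 < states p1" by simp
    then show ?thesis using IfTop.IH(1)[of "q - 1"] IfTop.prems 2
      by (auto split: prod.splits simp: apfst_def map_prod_def)
  next
    case 3
    then have "q - Suc (states p1) < states p2" using IfTop.prems by simp
    then show ?thesis using IfTop.IH(2)[of "q - Suc (states p1)"] IfTop.prems 3
      by (auto split: prod.splits simp: apfst_def map_prod_def)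
  qed
next
  case (WhileTop i c p)
  show ?case
  proof (cases "q = 0")
    case True
    then show ?thesis using WhileTop.prems keep_symbols by auto
  next
    case False
    then have "q - 1 < states p" using WhileTop.prems by simp
    then show ?thesis using WhileTop.IH[of "q - 1"] WhileTop.prems False
      by (auto split: prod.splits simp: apfst_def map_prod_def)
  qed
qed

lemma tm_wf_compile: "tm_wf (compile p)"
proof -
  have "case delta p q ss of (q', acts) \<Rightarrow>
      q' \<le> states p \<and> length acts = Suc (regs p) \<and> (\<forall>(s, d) \<in> set acts. s < 3)"
    if "q < states p" "length ss = Suc (regs p)" "\<forall>s \<in> set ss. s < 3" for q ss
    using delta_wf[of q p ss] that by simp
  then show ?thesis
    using regs_pos[of p] by (simp add: tm_wf_def compile_def Suc_le_eq)
qed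

text \<open>In contrast to \<open>tm_step\<close> there is no idling in the halting state: inside a
  larger program this number belongs to another instruction, so only genuine steps can be
  transported.\<close>

definition mstep :: "prog \<Rightarrow> ((nat \<times> tape list) \<times> (nat \<times> tape list)) set" where
  "mstep p = {((q, tps), (q', tps')). q < states p \<and>
     q' = fst (delta p q (map scan tps)) \<and> tps' = map2 act (snd (delta p q (map scan tps))) tps}"

lemma mstep_tm_step:
  assumes "(c, c') \<in> mstep p ^^ t"
  shows "(tm_step (compile p) ^^ t) c = c'"
proof -
  have "tm_step (compile p) a = b" if "(a, b) \<in> mstep p" for a b
    using that by (cases a, cases b) (auto simp: mstep_def tm_step_def compile_def case_prod_beta)
  then show ?thesis
    using assms by (induction t arbitrary: c') auto
qed

section \<open>Transport of runs from a subprogram to the enclosing program\<close>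

lemma relpow_map:
  assumes "\<And>c c'. (c, c') \<in> R \<Longrightarrow> (g c, g c') \<in> R'" "(c, c') \<in> R ^^ t"
  shows "(g c, g c') \<in> R' ^^ t"
  using assms(2) by (induction t arbitrary: c') (auto intro: assms(1))

lemma mstep_Seq1: "(c, c') \<in> mstep p ^^ t \<Longrightarrow> (c, c') \<in> mstep (p ;; q) ^^ t"
  by (rule relpow_map[where g = "\<lambda>c. c"]) (auto simp: mstep_def)

lemma mstep_Seq2:
  "((a, tps), (a', tps')) \<in> mstep q ^^ t \<Longrightarrow>
    ((states p + a, tps), (states p + a', tps')) \<in> mstep (p ;; q) ^^ t"
  by (drule relpow_map[where g = "apfst ((+) (states p))", rotated])
    (auto simp: mstep_def)

lemma mstep_If1:
  assumes "((a, tps), (a', tps')) \<in> mstep p ^^ t" "a < states p"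
  shows "((Suc a, tps), (if a' = states p then states (IfTop i c p q) else Suc a', tps'))
    \<in> mstep (IfTop i c p q) ^^ t"
  using relpow_map[where g = "apfst (\<lambda>a. if a = states p then states (IfTop i c p q) else Suc a)"
      and R' = "mstep (IfTop i c p q)", OF _ assms(1)] assms(2)
  by (auto simp: mstep_def split: if_splits)

lemma mstep_If2:
  "((a, tps), (a', tps')) \<in> mstep q ^^ t \<Longrightarrow>
    ((Suc (states p + a), tps), (Suc (states p + a'), tps')) \<in> mstep (IfTop i c p q) ^^ t"
  by (drule relpow_map[where g = "apfst (\<lambda>a. Suc (states p + a))", rotated])
    (auto simp: mstep_def)

lemma mstep_While:
  assumes "((a, tps), (a', tps')) \<in> mstep p ^^ t" "a < states p"
  shows "((Suc a, tps), (if a' = states p then 0 else Suc a', tps')) \<in> mstep (WhileTop i c p) ^^ t"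
  using relpow_map[where g = "apfst (\<lambda>a. if a = states p then 0 else Suc a)"
      and R' = "mstep (WhileTop i c p)", OF _ assms(1)] assms(2)
  by (auto simp: mstep_def split: if_splits)

lemma map2_act_keep: "map2 act (keep (map scan tps)) tps = tps"
  by (rule nth_equalityI) (auto simp: keep_def act_def scan_def)

lemma map2_act_update:
  "map2 act ((keep (map scan tps))[j := a]) tps = tps[j := act a (tps ! j)]"
  by (rule nth_equalityI, simp, rename_tac i, case_tac "i = j")
    (auto simp: keep_def act_def scan_def)


text \<open>
  A register is a stack whose top lies under the head. On the input tape the stack extends to the
  right, so that initially it is the input word; on the work tapes it extends to the left.
\<close>

definition stack_sign :: "nat \<Rightarrow> int" where
  "stack_sign i = (if i = 0 then 1 else -1)"

definition is_stack :: "int \<Rightarrow> tape \<Rightarrow> bool list \<Rightarrow> bool" where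
  "is_stack d tp xs \<longleftrightarrow> (\<forall>j. fst tp (snd tp + d * j) = word_cells xs j)"

type_synonym store = "(nat \<Rightarrow> bool list) \<times> bool list"

text \<open>Registers without a tape are unconstrained, so the same store also describes a program
  on the larger machine that contains it. The output head stands on the first blank cell, ready for
  \<open>Emit\<close>.\<close>

definition represents :: "tape list \<Rightarrow> store \<Rightarrow> bool" where
  "represents tps S \<longleftrightarrow> length tps \<ge> 2 \<and>
    (\<forall>i. tape_of i < length tps \<longrightarrow> is_stack (stack_sign i) (tps ! tape_of i) (fst S i)) \<and>
    tps ! 1 = (word_cells (snd S), int (length (snd S)))"

definition top_symbol :: "bool list \<Rightarrow> nat" where
  "top_symbol xs = word_cells xs 0"

lemma top_symbol_simps [simp]:
  "top_symbol [] = 0" "top_symbol (True # xs) = 2" "top_symbol (False # xs) = 1"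
  "top_symbol (b # xs) \<noteq> 0"
  by (auto simp: top_symbol_def word_cells_def)

lemma word_cells_Cons: "word_cells (b # xs) j = (if j = 0 then bit_symbol b else word_cells xs (j - 1))"
  by (auto simp: word_cells_def bit_symbol_def nth_Cons' nat_diff_distrib)

lemma word_cells_tl: "word_cells (tl xs) j = (if j = -1 then 0 else word_cells xs (j + 1))"
  by (cases xs) (auto simp: word_cells_Cons, auto simp: word_cells_def)

lemma word_cells_snoc: "word_cells (w @ [b]) = (word_cells w)(int (length w) := bit_symbol b)"
  by (auto simp: word_cells_def bit_symbol_def fun_eq_iff nth_append)

lemma scan_stack: "is_stack d tp xs \<Longrightarrow> scan tp = top_symbol xs"
  by (auto simp: is_stack_def scan_def top_symbol_def dest: spec[of _ 0])

lemma stack_pop: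
  assumes "is_stack (stack_sign i) tp xs"
  shows "is_stack (stack_sign i) (act (0, pop_dir i) tp) (tl xs)"
proof -
  have "snd tp + (stack_sign i + stack_sign i * j) = snd tp \<longleftrightarrow> j = -1" for j
    by (auto simp: stack_sign_def)
  moreover have "offset (pop_dir i) = stack_sign i"
    by (simp add: pop_dir_def stack_sign_def)
  moreover have "fst tp (snd tp + (stack_sign i + stack_sign i * j)) = word_cells xs (j + 1)" for j
    using assms unfolding is_stack_def by (metis distrib_left add.commute mult.right_neutral)
  ultimately show ?thesis
    by (simp add: is_stack_def act_def word_cells_tl add.assoc)
qed

lemma stack_push:
  assumes "is_stack (stack_sign i) tp xs"
  shows "is_stack (stack_sign i) (act (bit_symbol b, Stay) (act (scan tp, push_dir i) tp)) (b # xs)"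
proof -
  have "offset (push_dir i) = - stack_sign i"
    by (simp add: push_dir_def stack_sign_def)
  moreover have "stack_sign i * j = 0 \<longleftrightarrow> j = 0" for j
    by (auto simp: stack_sign_def)
  moreover have "fst tp (snd tp - stack_sign i + stack_sign i * j) = word_cells xs (j - 1)" for j
    using assms[unfolded is_stack_def, rule_format, of "j - 1"] by (simp add: algebra_simps)
  ultimately show ?thesis
    by (simp add: is_stack_def act_def word_cells_Cons scan_def)
qed

lemma tape_of_simps [simp]: "tape_of i \<noteq> 1" "tape_of i \<noteq> Suc 0" "Suc 0 \<noteq> tape_of i" "tape_of i = tape_of j \<longleftrightarrow> i = j"
  by (auto simp: tape_of_def)

lemma represents_update:
  assumes "represents tps (s, w)" "tape_of i < length tps" "is_stack (stack_sign i) tp xs"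
  shows "represents (tps[tape_of i := tp]) (s(i := xs), w)"
  using assms unfolding represents_def by (auto simp: nth_list_update)

lemma represents_emit:
  assumes "represents tps (s, w)"
  shows "represents (tps[1 := act (bit_symbol b, Move_Right) (tps ! 1)]) (s, w @ [b])"
  using assms unfolding represents_def
  by (auto simp: nth_list_update act_def word_cells_snoc)

text \<open>The time is an upper bound, so that costs may be rounded up at any point.\<close>

definition runs :: "prog \<Rightarrow> store \<Rightarrow> nat \<Rightarrow> store \<Rightarrow> bool" where
  "runs p S T S' \<longleftrightarrow>
    (\<forall>tps. regs p < length tps \<and> represents tps S \<longrightarrow>
      (\<exists>t \<le> T. \<exists>tps'. length tps' = length tps \<and> represents tps' S' \<and>
        ((0, tps), (states p, tps')) \<in> mstep p ^^ t))"

section \<open>Timed rules for the instructions and their compositions\<close>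

lemma runs_le: "runs p S t S' \<Longrightarrow> t \<le> T \<Longrightarrow> runs p S T S'"
  unfolding runs_def by (meson le_trans)

lemma scan_top:
  "represents tps (s, w) \<Longrightarrow> tape_of i < length tps \<Longrightarrow>
    map scan tps ! tape_of i = top_symbol (s i)"
  using scan_stack[of "stack_sign i" "tps ! tape_of i" "s i"] by (auto simp: represents_def)

lemma runs_Emit: "runs (Emit b) (s, w) 1 (s, w @ [b])"
  unfolding runs_def
proof (intro allI impI)
  fix tps assume a: "regs (Emit b) < length tps \<and> represents tps (s, w)"
  then have "represents (tps[1 := act (bit_symbol b, Move_Right) (tps ! 1)]) (s, w @ [b])"
    using represents_emit by blast
  moreover have "((0, tps), (1, tps[1 := act (bit_symbol b, Move_Right) (tps ! 1)])) \<in> mstep (Emit b) ^^ 1"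
    by (simp add: mstep_def map2_act_update)
  ultimately show "\<exists>t \<le> 1. \<exists>tps'. length tps' = length tps \<and> represents tps' (s, w @ [b]) \<and>
        ((0, tps), (states (Emit b), tps')) \<in> mstep (Emit b) ^^ t"
    by (metis length_list_update order_refl states.simps(3))
qed

lemma runs_Pop: "runs (Pop i) (s, w) 1 (s(i := tl (s i)), w)"
  unfolding runs_def
proof (intro allI impI)
  fix tps assume a: "regs (Pop i) < length tps \<and> represents tps (s, w)"
  then have i: "tape_of i < length tps" by (auto simp: tape_of_def)
  have "represents (tps[tape_of i := act (0, pop_dir i) (tps ! tape_of i)]) (s(i := tl (s i)), w)"
    using a i by (intro represents_update stack_pop) (auto simp: represents_def)
  moreover have "((0, tps), (1, tps[tape_of i := act (0, pop_dir i) (tps ! tape_of i)])) \<in> mstep (Pop i) ^^ 1"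
    by (simp add: mstep_def map2_act_update)
  ultimately show "\<exists>t \<le> 1. \<exists>tps'. length tps' = length tps \<and> represents tps' (s(i := tl (s i)), w) \<and>
        ((0, tps), (states (Pop i), tps')) \<in> mstep (Pop i) ^^ t"
    by (metis length_list_update order_refl states.simps(2))
qed

lemma runs_Push: "runs (Push i b) (s, w) 2 (s(i := b # s i), w)"
  unfolding runs_def
proof (intro allI impI)
  fix tps assume a: "regs (Push i b) < length tps \<and> represents tps (s, w)"
  then have i: "tape_of i < length tps" by (auto simp: tape_of_def)
  let ?tp = "tps ! tape_of i"
  let ?tp1 = "act (scan ?tp, push_dir i) ?tp"
  let ?tps' = "tps[tape_of i := act (bit_symbol b, Stay) ?tp1]"
  have "represents ?tps' (s(i := b # s i), w)"
    using a i by (intro represents_update stack_push) (auto simp: represents_def)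
  moreover have "((0, tps), (1, tps[tape_of i := ?tp1])) \<in> mstep (Push i b)"
    using i by (simp add: mstep_def map2_act_update)
  moreover have "((1, tps[tape_of i := ?tp1]), (2, ?tps')) \<in> mstep (Push i b)"
    using i by (simp add: mstep_def map2_act_update)
  ultimately show "\<exists>t \<le> 2. \<exists>tps'. length tps' = length tps \<and> represents tps' (s(i := b # s i), w) \<and>
        ((0, tps), (states (Push i b), tps')) \<in> mstep (Push i b) ^^ t"
    by (intro exI[of _ 2] conjI exI[of _ ?tps']) (auto simp: numeral_2_eq_2)
qed

lemma runs_Seq:
  assumes "runs p S t S1" "runs q S1 u S2"
  shows "runs (p ;; q) S (t + u) S2"
  unfolding runs_def
proof (intro allI impI)
  fix tps assume a: "regs (p ;; q) < length tps \<and> represents tps S"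
  then obtain t' tps1 where 1: "t' \<le> t" "length tps1 = length tps" "represents tps1 S1"
    "((0, tps), (states p, tps1)) \<in> mstep p ^^ t'"
    using assms(1) unfolding runs_def by auto
  then obtain u' tps2 where 2: "u' \<le> u" "length tps2 = length tps1" "represents tps2 S2"
    "((0, tps1), (states q, tps2)) \<in> mstep q ^^ u'"
    using assms(2)[unfolded runs_def, rule_format, of tps1] a by auto
  have "((0, tps), (states p + states q, tps2)) \<in> mstep (p ;; q) ^^ (t' + u')"
    using mstep_Seq1[OF 1(4), of q] mstep_Seq2[OF 2(4), of p] by (auto simp: relpow_add)
  then show "\<exists>t'' \<le> t + u. \<exists>tps'. length tps' = length tps \<and> represents tps' S2 \<and>
        ((0, tps), (states (p ;; q), tps')) \<in> mstep (p ;; q) ^^ t''"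
    using 1 2 by (intro exI[of _ "t' + u'"] conjI exI[of _ tps2]) auto
qed

lemma runs_If:
  assumes "runs (if c (top_symbol (s i)) then p else q) (s, w) t S'"
  shows "runs (IfTop i c p q) (s, w) (Suc t) S'"
  unfolding runs_def
proof (intro allI impI)
  fix tps assume a: "regs (IfTop i c p q) < length tps \<and> represents tps (s, w)"
  then have i: "tape_of i < length tps" by (auto simp: tape_of_def)
  let ?p = "if c (top_symbol (s i)) then p else q"
  let ?n = "if c (top_symbol (s i)) then 1 else Suc (states p)"
  obtain t' tps1 where 1: "t' \<le> t" "length tps1 = length tps" "represents tps1 S'"
    "((0, tps), (states ?p, tps1)) \<in> mstep ?p ^^ t'"
    using assms a unfolding runs_def by (fastforce split: if_splits)
  have "((0, tps), (?n, tps)) \<in> mstep (IfTop i c p q)"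
    using scan_top[of tps s w i] a i by (simp add: mstep_def map2_act_keep)
  moreover have "((?n, tps), (states (IfTop i c p q), tps1)) \<in> mstep (IfTop i c p q) ^^ t'"
    using mstep_If1[of 0 tps "states p" tps1 t' p i c q] mstep_If2[of 0 tps "states q" tps1 t' q p i c] 1(4)
    by (auto split: if_splits)
  ultimately have "((0, tps), (states (IfTop i c p q), tps1)) \<in> mstep (IfTop i c p q) ^^ Suc t'"
    by (blast intro: relpow_Suc_I2)
  then show "\<exists>t'' \<le> Suc t. \<exists>tps'. length tps' = length tps \<and> represents tps' S' \<and>
        ((0, tps), (states (IfTop i c p q), tps')) \<in> mstep (IfTop i c p q) ^^ t''"
    using 1 by (intro exI[of _ "Suc t'"] conjI exI[of _ tps1]) auto
qed

lemma runs_While_end: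
  assumes "\<not> c (top_symbol (s i))"
  shows "runs (WhileTop i c p) (s, w) 1 (s, w)"
  unfolding runs_def
proof (intro allI impI)
  fix tps assume a: "regs (WhileTop i c p) < length tps \<and> represents tps (s, w)"
  then have i: "tape_of i < length tps" by (auto simp: tape_of_def)
  have "((0, tps), (states (WhileTop i c p), tps)) \<in> mstep (WhileTop i c p) ^^ 1"
    using scan_top[of tps s w i] a i assms by (simp add: mstep_def map2_act_keep)
  then show "\<exists>t \<le> 1. \<exists>tps'. length tps' = length tps \<and> represents tps' (s, w) \<and>
        ((0, tps), (states (WhileTop i c p), tps')) \<in> mstep (WhileTop i c p) ^^ t"
    using a by blast
qed

lemma runs_While_step:
  assumes "c (top_symbol (s i))" "runs p (s, w) t S1" "runs (WhileTop i c p) S1 u S2"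
  shows "runs (WhileTop i c p) (s, w) (Suc t + u) S2"
  unfolding runs_def
proof (intro allI impI)
  let ?W = "WhileTop i c p"
  fix tps assume a: "regs ?W < length tps \<and> represents tps (s, w)"
  then have i: "tape_of i < length tps" by (auto simp: tape_of_def)
  obtain t' tps1 where 1: "t' \<le> t" "length tps1 = length tps" "represents tps1 S1"
    "((0, tps), (states p, tps1)) \<in> mstep p ^^ t'"
    using assms(2) a unfolding runs_def by auto
  then obtain u' tps2 where 2: "u' \<le> u" "length tps2 = length tps1" "represents tps2 S2"
    "((0, tps1), (states ?W, tps2)) \<in> mstep ?W ^^ u'"
    using assms(3)[unfolded runs_def, rule_format, of tps1] a by auto
  have "((0, tps), (1, tps)) \<in> mstep ?W"
    using scan_top[of tps s w i] a i assms(1) by (simp add: mstep_def map2_act_keep)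
  moreover have "((1, tps), (0, tps1)) \<in> mstep ?W ^^ t'"
    using mstep_While[OF 1(4)] by simp
  ultimately have "((0, tps), (states ?W, tps2)) \<in> mstep ?W ^^ (Suc t' + u')"
    using relpow_Suc_I2[of "(0, tps)" "(1, tps)"] 2(4) relpow_trans by metis
  then show "\<exists>t'' \<le> Suc t + u. \<exists>tps'. length tps' = length tps \<and> represents tps' S2 \<and>
        ((0, tps), (states ?W, tps')) \<in> mstep ?W ^^ t''"
    using 1 2 by (intro exI[of _ "Suc t' + u'"] conjI exI[of _ tps2]) auto
qed

theorem runs_computes_within:
  assumes "runs p ((\<lambda>_. [])(0 := v), []) T (s, w)"
  shows "computes_within (compile p) v w T"
proof -
  let ?k = "regs p"
  let ?tps = "(word_cells v, 0) # replicate ?k (word_cells [], 0)"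
  have "?tps ! 1 = (word_cells [], 0)"
    using regs_pos[of p] by simp
  then have "represents ?tps ((\<lambda>_. [])(0 := v), [])"
    using regs_pos[of p]
    by (auto simp: represents_def is_stack_def tape_of_def stack_sign_def word_cells_def Suc_le_eq)
  then obtain t tps' where "t \<le> T" "represents tps' (s, w)" "((0, ?tps), (states p, tps')) \<in> mstep p ^^ t"
    using assms unfolding runs_def
    by (metis length_Cons length_replicate lessI)
  moreover have "tm_start (compile p) v = (0, ?tps)"
    by (simp add: tm_start_def compile_def)
  ultimately show ?thesis
    using mstep_tm_step[of _ _ t p] unfolding computes_within_def
    by (intro exI[of _ t]) (auto simp: represents_def compile_def)
qed

section \<open>Macros\<close>

text \<open>Keeps the simplifier from expanding updated stores into \<open>\<lambda>\<close>-abstractions.\<close>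
declare fun_upd_apply [simp del] fun_upd_same [simp] fun_upd_other [simp]

lemma runs_conv: "runs p S T S1 \<Longrightarrow> S1 = S' \<Longrightarrow> T \<le> T' \<Longrightarrow> runs p S T' S'"
  using runs_le by blast

abbreviation while_one :: "nat \<Rightarrow> prog \<Rightarrow> prog" where
  "while_one i \<equiv> WhileTop i (\<lambda>a. a = 2)"

abbreviation while_nonempty :: "nat \<Rightarrow> prog \<Rightarrow> prog" where
  "while_nonempty i \<equiv> WhileTop i (\<lambda>a. a \<noteq> 0)"

abbreviation ones :: "nat \<Rightarrow> bool list" where
  "ones k \<equiv> replicate k True"

lemma encode_nats_simps [simp]:
  "encode_nats [] = []"
  "encode_nats (k # ks) = ones k @ False # encode_nats ks"
  "encode_nats (ks @ ls) = encode_nats ks @ encode_nats ls"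
  by (simp_all add: encode_nats_def)

lemma length_encode_nats: "length (encode_nats ks) = sum_list ks + length ks"
  by (induction ks) auto

lemma ones_snoc: "ones k @ True # xs = True # ones k @ xs"
  by (induction k) auto

lemma ones_if_no_False: "False \<notin> set xs \<Longrightarrow> xs = ones (length xs)"
  by (induction xs) auto

text \<open>The sequence \<open>S\<close> is the loop invariant, indexed by the number of completed
  passes; the counting loops below are verified by giving it in closed form. The extra step in the
  time is the last, failing test.\<close>

lemma runs_While_iterate:
  assumes "\<And>j. j < k \<Longrightarrow> c (top_symbol (fst (S j) i))" "\<And>j. j < k \<Longrightarrow> runs p (S j) t (S (Suc j))"
    and "\<not> c (top_symbol (fst (S k) i))"
  shows "runs (WhileTop i c p) (S 0) (k * Suc t + 1) (S k)"
  using assms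
proof (induction k arbitrary: S)
  case 0
  then show ?case using runs_While_end[of c "fst (S 0)" i p "snd (S 0)"] by simp
next
  case (Suc k)
  have *: "runs (WhileTop i c p) (S 1) (k * Suc t + 1) (S (Suc k))"
    using Suc.IH[of "\<lambda>j. S (Suc j)"] Suc.prems by simp
  from this have "runs (WhileTop i c p) (S 0) (Suc t + (k * Suc t + 1)) (S (Suc k))"
    using runs_While_step[of c "fst (S 0)" i p "snd (S 0)" t "S 1", OF _ _ *] Suc.prems(1,2)[of 0]
    by simp
  then show ?case
    by (rule runs_le) simp
qed

lemma runs_while_one:
  assumes "\<And>j. j < k \<Longrightarrow> runs p (S j) t (S (Suc j))"
    and "\<And>j. j \<le> k \<Longrightarrow> fst (S j) i = ones (k - j) @ r" "top_symbol r \<noteq> 2"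
  shows "runs (while_one i p) (S 0) (k * Suc t + 1) (S k)"
proof (rule runs_While_iterate)
  fix j assume "j < k"
  then have "k - j = Suc (k - Suc j)" by simp
  then show "top_symbol (fst (S j) i) = 2"
    using assms(2)[of j] \<open>j < k\<close> by simp
next
  show "\<not> top_symbol (fst (S k) i) = 2" using assms(2)[of k] assms(3) by simp
qed (use assms in auto)

section \<open>Unary numbers on stacks\<close>

fun emit_num :: "nat \<Rightarrow> prog" where
  "emit_num 0 = Emit False"
| "emit_num (Suc k) = Emit True ;; emit_num k"

lemma runs_emit_num: "runs (emit_num k) (s, w) (Suc k) (s, w @ encode_nats [k])"
proof (induction k arbitrary: w)
  case 0
  then show ?case using runs_Emit[of False s w] by simp
next
  case (Suc k)
  then show ?case using runs_Seq[OF runs_Emit[of True s w] Suc[of "w @ [True]"]] by simp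
qed

fun push_num :: "nat \<Rightarrow> nat \<Rightarrow> prog" where
  "push_num i 0 = Push i False"
| "push_num i (Suc k) = push_num i k ;; Push i True"

lemma runs_push_num: "runs (push_num i k) (s, w) (2 * k + 2) (s(i := encode_nats [k] @ s i), w)"
proof (induction k)
  case 0
  show ?case unfolding push_num.simps by (rule runs_conv[OF runs_Push]) auto
next
  case (Suc k)
  show ?case unfolding push_num.simps by (rule runs_conv[OF runs_Seq[OF Suc runs_Push]]) auto
qed

text \<open>Case distinction on a unary token: each one that is read discards an alternative and the
  terminating zero selects the current one, so the position in the list is the token.\<close>

fun dispatch :: "nat \<Rightarrow> prog list \<Rightarrow> prog" where
  "dispatch i [] = Pop i"
| "dispatch i (p # ps) = IfTop i (\<lambda>a. a = 2) (Pop i ;; dispatch i ps) (Pop i ;; p)"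

lemma runs_dispatch:
  assumes "k < length ps" "s i = encode_nats [k] @ r" "runs (ps ! k) (s(i := r), w) T S'"
  shows "runs (dispatch i ps) (s, w) (T + 2 * k + 2) S'"
  using assms
proof (induction ps arbitrary: k s)
  case (Cons p ps)
  show ?case
  proof (cases k)
    case 0
    have "tl (s i) = r" using Cons.prems(2) 0 by simp
    moreover have "runs p (s(i := r), w) T S'" using Cons.prems(3) unfolding 0 nth_Cons_0 .
    ultimately have "runs (Pop i ;; p) (s, w) (1 + T) S'"
      using runs_Seq[OF runs_Pop[of i s w]] by metis
    then have "runs (dispatch i (p # ps)) (s, w) (Suc (1 + T)) S'"
      using Cons.prems 0 unfolding dispatch.simps by (intro runs_If) simp
    then show ?thesis by (rule runs_le) simp
  next
    case (Suc k')
    let ?s = "s(i := encode_nats [k'] @ r)"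
    have "runs (ps ! k') (?s(i := r), w) T S'"
      using Cons.prems(3) unfolding Suc nth_Cons_Suc fun_upd_upd .
    from Cons.IH[OF _ _ this] have "runs (dispatch i ps) (?s, w) (T + 2 * k' + 2) S'"
      using Cons.prems(1) Suc by simp
    moreover have "tl (s i) = encode_nats [k'] @ r" using Cons.prems(2) Suc by simp
    ultimately have "runs (Pop i ;; dispatch i ps) (s, w) (1 + (T + 2 * k' + 2)) S'"
      using runs_Seq[OF runs_Pop[of i s w]] by metis
    then have "runs (dispatch i (p # ps)) (s, w) (Suc (1 + (T + 2 * k' + 2))) S'"
      using Cons.prems Suc unfolding dispatch.simps by (intro runs_If) simp
    then show ?thesis by (rule runs_le) (simp add: Suc)
  qed
qed simp

definition move :: "nat \<Rightarrow> nat \<Rightarrow> prog" where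
  "move i j = while_one i (Pop i ;; Push j True)"

lemma runs_move:
  assumes "s i = ones k @ r" "top_symbol r \<noteq> 2" "i \<noteq> j"
  shows "runs (move i j) (s, w) (4 * k + 1) (s(i := r, j := ones k @ s j), w)"
proof -
  let ?S = "\<lambda>l. (s(i := ones (k - l) @ r, j := ones l @ s j), w)"
  have *: "runs (Pop i ;; Push j True) (?S l) 3 (?S (Suc l))" if "l < k" for l
  proof -
    have "k - l = Suc (k - Suc l)" using that by simp
    then show ?thesis using assms(3)
      by (intro runs_conv[OF runs_Seq[OF runs_Pop runs_Push]]) (auto simp: fun_eq_iff fun_upd_apply)
  qed
  have "runs (move i j) (?S 0) (k * Suc 3 + 1) (?S k)"
    unfolding move_def by (rule runs_while_one[where S = ?S and r = r, OF *]) (use assms in auto)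
  moreover have "?S 0 = (s, w)" using assms by (auto simp: fun_eq_iff fun_upd_apply)
  ultimately show ?thesis by (simp add: mult.commute)
qed

text \<open>Reading a unary counter destroys it, hence the scratch register \<open>t\<close> from
  which it is restored. The terminator \<open>False\<close> is pushed first because it has to lie
  below the ones.\<close>

definition push_copy :: "nat \<Rightarrow> nat \<Rightarrow> nat \<Rightarrow> prog" where
  "push_copy i t j = Push j False ;; while_one i (Pop i ;; Push t True ;; Push j True) ;; move t i"

lemma runs_push_copy:
  assumes "s i = ones k" "s t = []" "i \<noteq> j" "i \<noteq> t" "t \<noteq> j"
  shows "runs (push_copy i t j) (s, w) (10 * k + 4) (s(j := encode_nats [k] @ s j), w)"
proof -
  let ?S = "\<lambda>l. (s(i := ones (k - l), t := ones l, j := ones l @ False # s j), w)"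
  have *: "runs (Pop i ;; Push t True ;; Push j True) (?S l) 5 (?S (Suc l))" if "l < k" for l
  proof -
    have "k - l = Suc (k - Suc l)" using that by simp
    then show ?thesis using assms(3-)
      by (intro runs_conv[OF runs_Seq[OF runs_Pop runs_Seq[OF runs_Push runs_Push]]])
        (auto simp: fun_eq_iff fun_upd_apply)
  qed
  have **: "runs (while_one i (Pop i ;; Push t True ;; Push j True)) (?S 0) (k * Suc 5 + 1) (?S k)"
    by (rule runs_while_one[where S = ?S and r = "[]", OF *]) (use assms in auto)
  have "runs (move t i) (?S k) (4 * k + 1) (s(j := encode_nats [k] @ s j), w)"
    using assms by (intro runs_conv[OF runs_move[where k = k and r = "[]"]]) (auto simp: fun_eq_iff fun_upd_apply)
  note runs_Seq[OF ** this]
  moreover have "?S 0 = (s(j := False # s j), w)" using assms by (auto simp: fun_eq_iff fun_upd_apply)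
  ultimately show ?thesis
    unfolding push_copy_def by (intro runs_conv[OF runs_Seq[OF runs_Push]]) auto
qed

definition emit_pop :: "nat \<Rightarrow> prog" where
  "emit_pop i = while_one i (Pop i ;; Emit True) ;; Pop i ;; Emit False"

lemma runs_emit_pop:
  assumes "s i = encode_nats [k] @ r"
  shows "runs (emit_pop i) (s, w) (3 * k + 3) (s(i := r), w @ encode_nats [k])"
proof -
  let ?S = "\<lambda>l. (s(i := ones (k - l) @ False # r), w @ ones l)"
  have *: "runs (Pop i ;; Emit True) (?S l) 2 (?S (Suc l))" if "l < k" for l
  proof -
    have "k - l = Suc (k - Suc l)" using that by simp
    then show ?thesis
      by (intro runs_conv[OF runs_Seq[OF runs_Pop runs_Emit]]) (auto simp: replicate_append_same)
  qed
  have "runs (while_one i (Pop i ;; Emit True)) (?S 0) (k * Suc 2 + 1) (?S k)"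
    by (rule runs_while_one[where S = ?S and r = "False # r", OF *]) auto
  moreover have "?S 0 = (s, w)" using assms by (auto simp: fun_eq_iff fun_upd_apply)
  ultimately show ?thesis
    unfolding emit_pop_def
    by (intro runs_conv[OF runs_Seq[OF _ runs_Seq[OF runs_Pop runs_Emit]]]) auto
qed

section \<open>Values of bit strings and of circuits\<close>

lemma binary_value_Nil [simp]: "binary_value [] = 0"
  by (simp add: binary_value_def)

lemma binary_value_Cons: "binary_value (a # as) = of_bool a * 2 ^ length as + binary_value as"
  by (simp add: binary_value_def horner_sum_append)

lemma binary_value_less: "binary_value as < 2 ^ length as"
  by (induction as) (auto simp: binary_value_Cons)

text \<open>The tail is worth less than the leading bit, so the order is lexicographic. The
  recursion of \<open>ge_formula\<close> follows this shape.\<close>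

lemma binary_value_Cons_le:
  assumes "length as = length bs"
  shows "binary_value (b # bs) \<le> binary_value (a # as) \<longleftrightarrow>
    a \<and> \<not> b \<or> (a \<or> \<not> b) \<and> binary_value bs \<le> binary_value as"
  using binary_value_less[of as] binary_value_less[of bs] assms
  by (auto simp: binary_value_Cons)

lemma binary_value_replicate_le:
  "k > 0 \<Longrightarrow> binary_value (replicate k b) \<le> binary_value (replicate k a) \<longleftrightarrow> (b \<longrightarrow> a)"
proof -
  have "binary_value (replicate k False) = 0" by (induction k) (auto simp: binary_value_Cons)
  moreover have "k > 0 \<Longrightarrow> binary_value (replicate k True) > 0"
    by (cases k) (auto simp: binary_value_Cons)
  ultimately show "k > 0 \<Longrightarrow> ?thesis" by (cases a; cases b) auto
qed

definition wires :: "gate list \<Rightarrow> bool list \<Rightarrow> bool list" where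
  "wires gs z = foldl (\<lambda>ws g. ws @ [gate_eval ws g]) z gs"

lemma circuit_eval_wires: "circuit_eval C z = map ((!) (wires (gates C) z)) (outputs C)"
  by (simp add: circuit_eval_def wires_def)

lemma wires_simps [simp]:
  "wires [] z = z" "wires (g # gs) z = wires gs (z @ [gate_eval z g])"
  "wires (gs @ hs) z = wires hs (wires gs z)"
  by (simp_all add: wires_def)

lemma length_wires [simp]: "length (wires gs z) = length z + length gs"
  by (induction gs arbitrary: z) auto

lemma nth_wires: "i < length z \<Longrightarrow> wires gs z ! i = z ! i"
  by (induction gs arbitrary: z) (auto simp: nth_append)

lemma formula_eval_cong:
  "(\<And>i. i \<in> formula_vars \<phi> \<Longrightarrow> y ! i = z ! i) \<Longrightarrow> formula_eval \<phi> y = formula_eval \<phi> z"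
  by (induction \<phi>) auto

fun rename :: "(nat \<Rightarrow> nat) \<Rightarrow> formula \<Rightarrow> formula" where
  "rename \<sigma> (FConst b) = FConst b"
| "rename \<sigma> (FVar i) = FVar (\<sigma> i)"
| "rename \<sigma> (FNot \<phi>) = FNot (rename \<sigma> \<phi>)"
| "rename \<sigma> (FAnd \<phi> \<psi>) = FAnd (rename \<sigma> \<phi>) (rename \<sigma> \<psi>)"
| "rename \<sigma> (FOr \<phi> \<psi>) = FOr (rename \<sigma> \<phi>) (rename \<sigma> \<psi>)"

lemma formula_vars_rename [simp]: "formula_vars (rename \<sigma> \<phi>) = \<sigma> ` formula_vars \<phi>"
  by (induction \<phi>) auto

lemma formula_eval_rename:
  "(\<And>i. i \<in> formula_vars \<phi> \<Longrightarrow> y ! \<sigma> i = z ! i) \<Longrightarrow>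
    formula_eval (rename \<sigma> \<phi>) y = formula_eval \<phi> z"
  by (induction \<phi>) auto

text \<open>
  Among the strategies whose payoff is nowhere exceeded, \<open>x\<close> is strictly better somewhere than every
  other one iff no other strategy has the same payoffs, that is, iff there is no other such strategy.
\<close>
lemma is_yes_WDom:
  "is_yes WDom_Strategy (n, C) \<longleftrightarrow>
    (\<exists>!x. x \<in> bit_strings n \<and> (\<forall>x' \<in> bit_strings n. \<forall>y \<in> bit_strings n.
      binary_value (circuit_eval C (x' @ y)) \<le> binary_value (circuit_eval C (x @ y))))"
proof -
  define B where "B = bit_strings n"
  define v where "v x y = binary_value (circuit_eval C (x @ y))" for x y
  \<comment> \<open>The strict inequality at \<open>y'\<close> becomes available only after
    instantiating \<open>y\<close>; strings exist for every length, including 0.\<close>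
  obtain y0 where y0: "y0 \<in> B" using length_replicate[of n False] unfolding B_def bit_strings_def by blast
  have "(\<exists>x \<in> B. \<forall>x' \<in> B. \<forall>y \<in> B. x' \<noteq> x \<longrightarrow> (\<exists>y' \<in> B. v x' y \<le> v x y \<and> v x' y' < v x y'))
    \<longleftrightarrow> (\<exists>!x. x \<in> B \<and> (\<forall>x' \<in> B. \<forall>y \<in> B. v x' y \<le> v x y))" (is "?L \<longleftrightarrow> ?R")
  proof
    assume ?L
    then obtain x where x: "x \<in> B"
      "\<And>x' y. x' \<in> B \<Longrightarrow> y \<in> B \<Longrightarrow> x' \<noteq> x \<Longrightarrow> \<exists>y' \<in> B. v x' y \<le> v x y \<and> v x' y' < v x y'"
      by blast
    show ?R
    proof (rule ex1I[of _ x])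
      show "x \<in> B \<and> (\<forall>x' \<in> B. \<forall>y \<in> B. v x' y \<le> v x y)" using x by blast
    next
      fix x' assume x': "x' \<in> B \<and> (\<forall>x'' \<in> B. \<forall>y \<in> B. v x'' y \<le> v x' y)"
      then show "x' = x" using x(2)[of x' y0] x(1) y0 by (meson not_le)
    qed
  next
    assume ?R
    then obtain x where x: "x \<in> B" "\<And>x' y. x' \<in> B \<Longrightarrow> y \<in> B \<Longrightarrow> v x' y \<le> v x y"
      and u: "\<And>x'. x' \<in> B \<Longrightarrow> \<forall>x'' \<in> B. \<forall>y \<in> B. v x'' y \<le> v x' y \<Longrightarrow> x' = x"
      by blast
    \<comment> \<open>A competitor that never does strictly worse than \<open>x\<close> is itself
      nowhere exceeded, contradicting uniqueness.\<close>
    have "\<exists>y' \<in> B. v x' y' < v x y'" if "x' \<in> B" "x' \<noteq> x" for x'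
      using u[OF that(1)] x(2) that(2) by (meson not_le order_trans)
    then show ?L using x by blast
  qed
  then show ?thesis by (simp add: WDom_Strategy_def Let_def B_def v_def)
qed


section \<open>Reducing \<open>UEA_Sat\<close> to \<open>WDom_Strategy\<close>\<close>

fun gate_count :: "formula \<Rightarrow> nat" where
  "gate_count (FConst b) = 1"
| "gate_count (FVar i) = 0"
| "gate_count (FNot \<phi>) = Suc (gate_count \<phi>)"
| "gate_count (FAnd \<phi> \<psi>) = Suc (gate_count \<phi> + gate_count \<psi>)"
| "gate_count (FOr \<phi> \<psi>) = Suc (gate_count \<phi> + gate_count \<psi>)"

text \<open>Here \<open>w\<close> is the first free wire. A variable costs no gate and is its own
  wire; any other formula ends with the gate that computes its value.\<close>

definition out_wire :: "nat \<Rightarrow> formula \<Rightarrow> nat" where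
  "out_wire w \<phi> = (case \<phi> of FVar i \<Rightarrow> i | _ \<Rightarrow> w + gate_count \<phi> - 1)"

lemma out_wire_simps [simp]:
  "out_wire w (FConst b) = w"
  "out_wire w (FVar i) = i"
  "out_wire w (FNot \<phi>) = w + gate_count \<phi>"
  "out_wire w (FAnd \<phi> \<psi>) = w + gate_count \<phi> + gate_count \<psi>"
  "out_wire w (FOr \<phi> \<psi>) = w + gate_count \<phi> + gate_count \<psi>"
  by (simp_all add: out_wire_def)

text \<open>The right operand is listed first because it lies on top of the stack when
  \<open>binary_gate\<close> pops and prints the two wires.\<close>

fun comp_gates :: "nat \<Rightarrow> formula \<Rightarrow> gate list" where
  "comp_gates w (FConst b) = [GConst b]"
| "comp_gates w (FVar i) = []"
| "comp_gates w (FNot \<phi>) = comp_gates w \<phi> @ [GNot (out_wire w \<phi>)]"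
| "comp_gates w (FAnd \<phi> \<psi>) = comp_gates w \<phi> @ comp_gates (w + gate_count \<phi>) \<psi> @
    [GAnd (out_wire (w + gate_count \<phi>) \<psi>) (out_wire w \<phi>)]"
| "comp_gates w (FOr \<phi> \<psi>) = comp_gates w \<phi> @ comp_gates (w + gate_count \<phi>) \<psi> @
    [GOr (out_wire (w + gate_count \<phi>) \<psi>) (out_wire w \<phi>)]"

lemma length_comp_gates [simp]: "length (comp_gates w \<phi>) = gate_count \<phi>"
  by (induction \<phi> arbitrary: w) auto

lemma gate_count_rename [simp]: "gate_count (rename \<sigma> \<phi>) = gate_count \<phi>"
  by (induction \<phi>) auto

lemma gate_count_le: "gate_count \<phi> \<le> length (formula_tokens \<phi>)"
  by (induction \<phi>) auto

lemma out_wire_less: "formula_vars \<phi> \<subseteq> {..<w} \<Longrightarrow> out_wire w \<phi> < w + gate_count \<phi>"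
  by (cases \<phi>) auto

lemma comp_gates_wires:
  "formula_vars \<phi> \<subseteq> {..<w} \<Longrightarrow> j < gate_count \<phi> \<Longrightarrow> gate_wires (comp_gates w \<phi> ! j) \<subseteq> {..<w + j}"
proof (induction \<phi> arbitrary: w j)
  case (FNot \<phi>)
  then show ?case using out_wire_less[of \<phi> w] by (auto simp: nth_append less_Suc_eq)
next
  case (FAnd \<phi> \<psi>)
  have "formula_vars \<psi> \<subseteq> {..<w + gate_count \<phi>}" using FAnd.prems(1) by auto
  then show ?case
    using FAnd.IH(1)[of w j] FAnd.IH(2)[of "w + gate_count \<phi>" "j - gate_count \<phi>"] FAnd.prems
      out_wire_less[of \<phi> w] out_wire_less[of \<psi> "w + gate_count \<phi>"]
    by (auto simp: nth_append less_Suc_eq)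
next
  case (FOr \<phi> \<psi>)
  have "formula_vars \<psi> \<subseteq> {..<w + gate_count \<phi>}" using FOr.prems(1) by auto
  then show ?case
    using FOr.IH(1)[of w j] FOr.IH(2)[of "w + gate_count \<phi>" "j - gate_count \<phi>"] FOr.prems
      out_wire_less[of \<phi> w] out_wire_less[of \<psi> "w + gate_count \<phi>"]
    by (auto simp: nth_append less_Suc_eq)
qed auto

lemma comp_gates_eval:
  "formula_vars \<phi> \<subseteq> {..<length ws} \<Longrightarrow>
    wires (comp_gates (length ws) \<phi>) ws ! out_wire (length ws) \<phi> = formula_eval \<phi> ws"
proof -
  \<comment> \<open>Serves both connectives. Gates only append wires, so the gates of
    \<open>\<psi>\<close> leave the result of \<open>\<phi>\<close> alone, and \<open>\<psi>\<close>
    reads its variables unchanged from the extended list.\<close>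
  have binary: "wires (comp_gates (w + gate_count \<phi>) \<psi>) (wires (comp_gates w \<phi>) ws) ! out_wire w \<phi>
        = formula_eval \<phi> ws"
      "wires (comp_gates (w + gate_count \<phi>) \<psi>) (wires (comp_gates w \<phi>) ws) ! out_wire (w + gate_count \<phi>) \<psi>
        = formula_eval \<psi> ws"
    if "w = length ws" and v: "formula_vars \<phi> \<subseteq> {..<length ws}" "formula_vars \<psi> \<subseteq> {..<length ws}"
      and IH: "wires (comp_gates (length ws) \<phi>) ws ! out_wire (length ws) \<phi> = formula_eval \<phi> ws"
        "\<And>ws. formula_vars \<psi> \<subseteq> {..<length ws} \<Longrightarrow>
          wires (comp_gates (length ws) \<psi>) ws ! out_wire (length ws) \<psi> = formula_eval \<psi> ws"
    for \<phi> \<psi> ws w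
  proof -
    let ?ws = "wires (comp_gates w \<phi>) ws"
    show "wires (comp_gates (w + gate_count \<phi>) \<psi>) ?ws ! out_wire w \<phi> = formula_eval \<phi> ws"
      using IH(1) out_wire_less[OF v(1)] that(1) by (simp add: nth_wires)
    have "formula_eval \<psi> ?ws = formula_eval \<psi> ws"
      using v(2) by (intro formula_eval_cong nth_wires) auto
    moreover have "formula_vars \<psi> \<subseteq> {..<length ?ws}" using v(2) by auto
    ultimately show "wires (comp_gates (w + gate_count \<phi>) \<psi>) ?ws ! out_wire (w + gate_count \<phi>) \<psi>
        = formula_eval \<psi> ws"
      using IH(2)[of ?ws] that(1) by simp
  qed
  show "formula_vars \<phi> \<subseteq> {..<length ws} \<Longrightarrow> ?thesis"
  proof (induction \<phi> arbitrary: ws)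
    case (FNot \<phi>)
    then show ?case by (simp add: nth_append)
  next
    case (FAnd \<phi> \<psi>)
    then show ?case using binary[of "length ws" ws \<phi> \<psi>] by (auto simp: nth_append)
  next
    case (FOr \<phi> \<psi>)
    then show ?case using binary[of "length ws" ws \<phi> \<psi>] by (auto simp: nth_append)
  qed auto
qed

text \<open>
  In the templates the variable 2 stands for the last bit \<open>c\<close> of the opponent's string. A strategy
  now starts with two bits \<open>b\<close>, \<open>b'\<close>: with \<open>b = b' = True\<close> it plays \<open>\<psi>\<close>, while the two strategies
  with \<open>b \<noteq> b'\<close> have the payoffs \<open>c\<close> and \<open>\<not> c\<close>. Hence a strategy is nowhere exceeded only if its
  payoff is constantly true.
\<close>
definition guard1 :: formula where
  "guard1 = FAnd (FOr (FVar 0) (FVar 2)) (FOr (FVar 1) (FNot (FVar 2)))"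

definition guard2 :: formula where
  "guard2 = FOr (FNot (FVar 0)) (FNot (FVar 1))"

definition instantiate :: "nat \<Rightarrow> formula \<Rightarrow> formula" where
  "instantiate c = rename (\<lambda>i. if i < 2 then i else c)"

text \<open>The new bits stand before \<open>x\<close> and after \<open>y\<close>, so
  \<open>x @ y\<close> stays contiguous and a single shift by 2 serves all variables of
  \<open>\<psi>\<close>. The opponent's two new bits have the indices \<open>2 * n + 2\<close> and
  \<open>2 * n + 3\<close>, the latter being \<open>c\<close>. If both \<open>b\<close> and
  \<open>b'\<close> are false, \<open>guard1\<close> reads \<open>c \<and> \<not> c\<close> and the
  strategy always loses.\<close>

definition game_formula :: "nat \<Rightarrow> formula \<Rightarrow> formula" where
  "game_formula n \<psi> = FAnd (instantiate (2 * n + 3) guard1)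
     (FOr (instantiate (2 * n + 3) guard2) (rename (\<lambda>i. i + 2) \<psi>))"

text \<open>
  Only the most significant output carries the payoff. The other ones repeat the first input, which
  is harmless because it favours the strategies with \<open>b = True\<close>, and saves copying \<open>out_wire\<close>.
\<close>
definition game_circuit :: "nat \<Rightarrow> formula \<Rightarrow> circuit" where
  "game_circuit n \<psi> = \<lparr>gates = comp_gates (2 * n + 4) (game_formula n \<psi>),
     outputs = out_wire (2 * n + 4) (game_formula n \<psi>) # replicate (n + 1) 0\<rparr>"

section \<open>Correctness of the game circuit\<close>

lemma game_formula_vars:
  "formula_vars \<psi> \<subseteq> {..<2 * n} \<Longrightarrow> formula_vars (game_formula n \<psi>) \<subseteq> {..<2 * n + 4}"
  by (auto simp: game_formula_def instantiate_def guard1_def guard2_def split: if_splits)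

lemma is_instance_game:
  assumes "is_instance UEA_Sat (n, \<psi>)"
  shows "is_instance WDom_Strategy (n + 2, game_circuit n \<psi>)"
proof -
  have "formula_vars (game_formula n \<psi>) \<subseteq> {..<2 * n + 4}"
    using game_formula_vars assms by (simp add: UEA_Sat_def)
  from out_wire_less[OF this] comp_gates_wires[OF this]
  have "out_wire (2 * n + 4) (game_formula n \<psi>) < 2 * (n + 2) + gate_count (game_formula n \<psi>)"
    "\<And>i j. j < gate_count (game_formula n \<psi>) \<Longrightarrow>
      i \<in> gate_wires (comp_gates (2 * n + 4) (game_formula n \<psi>) ! j) \<Longrightarrow> i < 2 * (n + 2) + j"
    by (simp, force simp: subset_iff)
  then show ?thesis
    by (simp add: WDom_Strategy_def is_circuit_def game_circuit_def)
qed

lemma game_circuit_eval: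
  assumes "formula_vars \<psi> \<subseteq> {..<2 * n}" "length x = n" "length y = n"
  shows "circuit_eval (game_circuit n \<psi>) ((b # b' # x) @ y @ [c', c]) =
    ((b \<or> c) \<and> (b' \<or> \<not> c) \<and> (\<not> b \<or> \<not> b' \<or> formula_eval \<psi> (x @ y))) # replicate (n + 1) b"
proof -
  let ?z = "(b # b' # x) @ y @ [c', c]"
  have len: "length ?z = 2 * n + 4" using assms by simp
  have c: "(x @ y @ [c', c]) ! Suc (2 * n) = c"
    using assms by (simp add: nth_append)
  have "formula_eval (rename (\<lambda>i. i + 2) \<psi>) ?z = formula_eval \<psi> (x @ y)"
    using assms by (intro formula_eval_rename) (auto simp: nth_append)
  then have "formula_eval (game_formula n \<psi>) ?z =
      ((b \<or> c) \<and> (b' \<or> \<not> c) \<and> (\<not> b \<or> \<not> b' \<or> formula_eval \<psi> (x @ y)))"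
    using c by (auto simp: game_formula_def guard1_def guard2_def instantiate_def nth_Cons')
  moreover have "wires (comp_gates (2 * n + 4) (game_formula n \<psi>)) ?z ! 0 = b"
    using nth_wires[of 0 ?z] by simp
  moreover have "wires (comp_gates (2 * n + 4) (game_formula n \<psi>)) ?z !
      out_wire (2 * n + 4) (game_formula n \<psi>) = formula_eval (game_formula n \<psi>) ?z"
    using comp_gates_eval[of "game_formula n \<psi>" ?z] game_formula_vars[OF assms(1)] unfolding len by simp
  ultimately show ?thesis
    by (simp add: circuit_eval_wires game_circuit_def)
qed

lemma is_yes_game:
  assumes "is_instance UEA_Sat (n, \<psi>)"
  shows "is_yes UEA_Sat (n, \<psi>) \<longleftrightarrow> is_yes WDom_Strategy (n + 2, game_circuit n \<psi>)"
proof -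
  have v: "formula_vars \<psi> \<subseteq> {..<2 * n}" using assms by (simp add: UEA_Sat_def)
  let ?B = "bit_strings (n + 2)"
  let ?val = "\<lambda>z. binary_value (circuit_eval (game_circuit n \<psi>) z)"
  define opt where "opt x \<longleftrightarrow> x \<in> ?B \<and> (\<forall>x' \<in> ?B. \<forall>y \<in> ?B. ?val (x' @ y) \<le> ?val (x @ y))" for x
  define good where "good x \<longleftrightarrow> x \<in> bit_strings n \<and> (\<forall>y \<in> bit_strings n. formula_eval \<psi> (x @ y))" for x
  define pay where "pay b b' x y c \<longleftrightarrow>
    (b \<or> c) \<and> (b' \<or> \<not> c) \<and> (\<not> b \<or> \<not> b' \<or> formula_eval \<psi> (x @ y))" for b b' x y c
  \<comment> \<open>Lexicographic: the payoff bit decides, and ties go by the repeated first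
    bit.\<close>
  have le: "?val ((b1 # b1' # x1) @ y @ [c', c]) \<le> ?val ((b # b' # x) @ y @ [c', c]) \<longleftrightarrow>
      pay b b' x y c \<and> \<not> pay b1 b1' x1 y c \<or> (pay b b' x y c \<or> \<not> pay b1 b1' x1 y c) \<and> (b1 \<longrightarrow> b)"
    if "length x1 = n" "length x = n" "length y = n" for b b' x b1 b1' x1 y c' c
    unfolding game_circuit_eval[OF v that(1,3)] game_circuit_eval[OF v that(2,3)]
    using binary_value_replicate_le[of "n + 1" b1 b]
    by (subst binary_value_Cons_le) (simp_all only: pay_def length_replicate add_gr_0 zero_less_one simp_thms)
  have B1: "b # b' # x \<in> ?B \<longleftrightarrow> length x = n" for b b' x
    by (simp add: bit_strings_def)
  have B1': "\<exists>b b' x. z = b # b' # x \<and> length x = n" if "z \<in> ?B" for z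
    using that by (auto simp: bit_strings_def length_Suc_conv numeral_2_eq_2)
  have B2: "\<exists>y c' c. z = y @ [c', c] \<and> length y = n" if "z \<in> ?B" for z
  proof (intro exI conjI)
    show "z = take n z @ [z ! n, z ! Suc n]" "length (take n z) = n"
      using that append_take_drop_id[of n z] Cons_nth_drop_Suc[of n z] Cons_nth_drop_Suc[of "Suc n" z]
      by (auto simp: bit_strings_def)
  qed
  have B3: "y @ [c', c] \<in> ?B" if "length y = n" for y c' c
    using that by (simp add: bit_strings_def)
  have opt_good: "opt z \<longleftrightarrow> (\<exists>x. z = True # True # x \<and> good x)" for z
  proof
    assume "opt z"
    then obtain b b' x where z: "z = b # b' # x" and x: "length x = n"
      using B1' unfolding opt_def by blast
    \<comment> \<open>Against an opponent ending in \<open>c\<close>, the strategy with bits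
      \<open>\<not> c\<close> and \<open>c\<close> wins, so one that is nowhere exceeded must win
      too.\<close>
    have pay: "pay b b' x y c" if y: "length y = n" for y c
    proof -
      have "?val (((\<not> c) # c # x) @ y @ [c, c]) \<le> ?val (z @ y @ [c, c])"
        using \<open>opt z\<close> B3[OF y] x B1[of "\<not> c" c x] unfolding opt_def by blast
      moreover have "pay (\<not> c) c x y c" by (simp add: pay_def)
      ultimately show ?thesis using le[OF x x y, of "\<not> c" c c c b b'] z by simp
    qed
    \<comment> \<open>Winning for \<open>c = True\<close> forces \<open>b'\<close>, winning for
      \<open>c = False\<close> forces \<open>b\<close>; any \<open>y\<close> serves.\<close>
    then have "b \<and> b'" using pay[of "replicate n False" True] pay[of "replicate n False" False]
      by (simp add: pay_def)
    moreover have "formula_eval \<psi> (x @ y)" if "length y = n" for y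
      using pay[OF that, of True] \<open>b \<and> b'\<close> by (simp add: pay_def)
    ultimately show "\<exists>x. z = True # True # x \<and> good x"
      using z x by (auto simp: good_def bit_strings_def)
  next
    assume "\<exists>x. z = True # True # x \<and> good x"
    then obtain x where z: "z = True # True # x" and x: "length x = n"
      and ev: "\<And>y. length y = n \<Longrightarrow> formula_eval \<psi> (x @ y)"
      by (auto simp: good_def bit_strings_def)
    have "?val (z' @ y) \<le> ?val (z @ y)" if "z' \<in> ?B" "y \<in> ?B" for z' y
    proof -
      obtain b1 b1' x1 where z': "z' = b1 # b1' # x1" "length x1 = n" using B1'[OF \<open>z' \<in> ?B\<close>] by blast
      obtain y1 c' c where y: "y = y1 @ [c', c]" "length y1 = n" using B2[OF \<open>y \<in> ?B\<close>] by blast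
      \<comment> \<open>Always winning is enough: if the competitor wins as well, the remaining
        outputs repeat \<open>True\<close> and cannot be exceeded.\<close>
      have "pay True True x y1 c" using ev[OF y(2)] by (simp add: pay_def)
      then show ?thesis using le[OF z'(2) x y(2), of b1 b1' c' c True True] unfolding z z' y by blast
    qed
    then show "opt z" using B1 x z unfolding opt_def by blast
  qed
  have "is_yes WDom_Strategy (n + 2, game_circuit n \<psi>) \<longleftrightarrow> (\<exists>!z. opt z)"
    unfolding is_yes_WDom opt_def ..
  also have "\<dots> \<longleftrightarrow> (\<exists>!x. good x)"
    unfolding opt_good by auto
  also have "\<dots> \<longleftrightarrow> is_yes UEA_Sat (n, \<psi>)"
    by (simp add: UEA_Sat_def good_def)
  finally show ?thesis by simp
qed

text \<open>
  Register 1 holds the stack of wires, register 2 the next free wire, register 4 the wire of \<open>c\<close> and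
  register 5 the number of remaining outputs; register 3 is scratch space.
\<close>
definition comp_store :: "bool list \<Rightarrow> bool list \<Rightarrow> nat \<Rightarrow> nat \<Rightarrow> nat \<Rightarrow> nat \<Rightarrow> bool list" where
  "comp_store inp stk W C N = (\<lambda>_. [])(0 := inp, 1 := stk, 2 := ones W, 4 := ones C, 5 := ones N)"

lemma comp_store_nth [simp]:
  "comp_store inp stk W C N 0 = inp" "comp_store inp stk W C N (Suc 0) = stk"
  "comp_store inp stk W C N 2 = ones W" "comp_store inp stk W C N 3 = []"
  "comp_store inp stk W C N 4 = ones C" "comp_store inp stk W C N 5 = ones N"
  by (auto simp: comp_store_def fun_upd_apply)

lemma comp_store_upd [simp]:
  "(comp_store inp stk W C N)(0 := inp') = comp_store inp' stk W C N"
  "(comp_store inp stk W C N)(Suc 0 := stk') = comp_store inp stk' W C N"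
  "False \<notin> set xs \<Longrightarrow> (comp_store inp stk W C N)(2 := xs) = comp_store inp stk (length xs) C N"
  "False \<notin> set xs \<Longrightarrow> (comp_store inp stk W C N)(4 := xs) = comp_store inp stk W (length xs) N"
  "False \<notin> set xs \<Longrightarrow> (comp_store inp stk W C N)(5 := xs) = comp_store inp stk W C (length xs)"
  by (auto simp: comp_store_def fun_upd_apply fun_eq_iff ones_if_no_False[symmetric])

text \<open>A gate just printed drives the next free wire, whose number becomes the result on the
  stack.\<close>

definition end_gate :: prog where
  "end_gate = push_copy 2 3 1 ;; Push 2 True"

definition const_gate :: "bool \<Rightarrow> prog" where
  "const_gate b = emit_num (of_bool b) ;; end_gate"

definition not_gate :: prog where
  "not_gate = emit_num 2 ;; emit_pop 1 ;; end_gate"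

definition binary_gate :: "nat \<Rightarrow> prog" where
  "binary_gate k = emit_num k ;; emit_pop 1 ;; emit_pop 1 ;; end_gate"

definition push_var :: prog where
  "push_var = push_num 1 2 ;; move 0 1 ;; Pop 0"

text \<open>The guards are known when the machine is built, so they are unrolled into code; only
  \<open>\<psi>\<close> is interpreted token by token. The wire of \<open>c\<close> depends on
  \<open>n\<close> and is taken from register 4.\<close>

fun template :: "formula \<Rightarrow> prog" where
  "template (FConst b) = const_gate b"
| "template (FVar i) = (if i < 2 then push_num 1 i else push_copy 4 3 1)"
| "template (FNot \<phi>) = template \<phi> ;; not_gate"
| "template (FAnd \<phi> \<psi>) = template \<phi> ;; template \<psi> ;; binary_gate 3"
| "template (FOr \<phi> \<psi>) = template \<phi> ;; template \<psi> ;; binary_gate 4"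

definition token_programs :: "prog list" where
  "token_programs = [const_gate False, const_gate True, push_var, not_gate, binary_gate 3, binary_gate 4]"

definition comp_loop :: prog where
  "comp_loop = while_nonempty 0 (dispatch 0 token_programs)"

text \<open>The pushes after the loop complete \<open>2 * n + 4\<close> inputs, the wire
  \<open>2 * n + 3\<close> of \<open>c\<close>, and \<open>n + 1\<close> further outputs;
  \<open>emit_num 2\<close> completes the \<open>n\<close> ones already printed to the number
  \<open>n + 2\<close>.\<close>

definition read_size :: prog where
  "read_size =
    while_one 0 (Pop 0 ;; Push 2 True ;; Push 2 True ;; Push 4 True ;; Push 4 True ;; Push 5 True ;; Emit True) ;;
    Pop 0 ;; Push 2 True ;; Push 2 True ;; Push 2 True ;; Push 2 True ;;
    Push 4 True ;; Push 4 True ;; Push 4 True ;; Push 5 True ;; emit_num 2"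

text \<open>The results of the guards wait on the stack below that of \<open>\<psi>\<close>; the
  closing gates 4 and 3 are the outer \<open>FOr\<close> and \<open>FAnd\<close> of
  \<open>game_formula\<close>. Each further output is wire 0, whose code is a single
  \<open>False\<close>.\<close>

definition game_prog :: prog where
  "game_prog = read_size ;; template guard1 ;; template guard2 ;; comp_loop ;; binary_gate 4 ;; binary_gate 3 ;;
    emit_num 5 ;; emit_pop 1 ;; while_one 5 (Pop 5 ;; Emit False)"

text \<open>For wires up to \<open>B\<close>, copying the wire counter costs \<open>10 * B\<close>
  and popping two operands \<open>3 * B\<close> each, up to constants.\<close>

definition token_time :: "nat \<Rightarrow> nat" where
  "token_time B = 16 * B + 20"

abbreviation encode_gates :: "gate list \<Rightarrow> bool list" where
  "encode_gates gs \<equiv> encode_nats (concat (map gate_tokens gs))"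

lemma runs_end_gate:
  "runs end_gate (comp_store inp stk W C N, v) (10 * W + 6)
    (comp_store inp (encode_nats [W] @ stk) (Suc W) C N, v)"
  unfolding end_gate_def
  by (rule runs_conv[OF runs_Seq[OF runs_push_copy[where k = W] runs_Push]]) auto

lemma runs_const_gate:
  assumes "W \<le> B"
  shows "runs (const_gate b) (comp_store inp stk W C N, v) (token_time B)
    (comp_store inp (encode_nats [W] @ stk) (Suc W) C N, v @ encode_gates [GConst b])"
  unfolding const_gate_def
  by (rule runs_conv[OF runs_Seq[OF runs_emit_num runs_end_gate]]) (use assms in \<open>auto simp: token_time_def\<close>)

lemma runs_not_gate:
  assumes "W \<le> B" "a \<le> B"
  shows "runs not_gate (comp_store inp (encode_nats [a] @ stk) W C N, v) (token_time B)
    (comp_store inp (encode_nats [W] @ stk) (Suc W) C N, v @ encode_gates [GNot a])"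
proof -
  have "runs (emit_pop 1) (comp_store inp (encode_nats [a] @ stk) W C N, v') (3 * a + 3)
      (comp_store inp stk W C N, v' @ encode_nats [a])" for v'
    by (rule runs_conv[OF runs_emit_pop[where k = a and r = stk]]) auto
  from runs_Seq[OF runs_emit_num runs_Seq[OF this runs_end_gate]] show ?thesis
    unfolding not_gate_def by (rule runs_conv) (use assms in \<open>auto simp: token_time_def\<close>)
qed

lemma runs_binary_gate:
  assumes "W \<le> B" "a \<le> B" "b \<le> B" "k \<le> 4" "gate_tokens g = [k, b, a]"
  shows "runs (binary_gate k) (comp_store inp (encode_nats [b] @ encode_nats [a] @ stk) W C N, v) (token_time B)
    (comp_store inp (encode_nats [W] @ stk) (Suc W) C N, v @ encode_gates [g])"
proof -
  have *: "runs (emit_pop 1) (comp_store inp (encode_nats [a] @ s) W C N, v') (3 * a + 3)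
      (comp_store inp s W C N, v' @ encode_nats [a])" for v' a s
    by (rule runs_conv[OF runs_emit_pop[where k = a and r = s]]) auto
  from runs_Seq[OF runs_emit_num runs_Seq[OF * runs_Seq[OF * runs_end_gate]]] show ?thesis
    unfolding binary_gate_def by (rule runs_conv) (use assms in \<open>auto simp: token_time_def\<close>)
qed

lemma runs_push_var:
  assumes "i \<le> B"
  shows "runs push_var (comp_store (encode_nats [i] @ inp) stk W C N, v) (token_time B)
    (comp_store inp (encode_nats [i + 2] @ stk) W C N, v)"
  unfolding push_var_def
  by (rule runs_conv[OF runs_Seq[OF runs_push_num runs_Seq[OF runs_move[where k = i and r = "False # inp"] runs_Pop]]])
    (use assms in \<open>auto simp: token_time_def numeral_2_eq_2 ones_snoc\<close>)

lemma out_wire_le: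
  "formula_vars \<phi> \<subseteq> {..B} \<Longrightarrow> W + gate_count \<phi> \<le> B \<Longrightarrow> out_wire W \<phi> \<le> B"
  by (cases \<phi>) auto

lemma runs_template:
  assumes "formula_vars (instantiate C \<phi>) \<subseteq> {..B}" "W + gate_count \<phi> \<le> B" "C \<le> B"
  shows "runs (template \<phi>) (comp_store inp stk W C N, v) (length (formula_tokens \<phi>) * token_time B)
    (comp_store inp (encode_nats [out_wire W (instantiate C \<phi>)] @ stk) (W + gate_count \<phi>) C N,
     v @ encode_gates (comp_gates W (instantiate C \<phi>)))"
  using assms unfolding instantiate_def
proof (induction \<phi> arbitrary: stk W v)
  case (FConst b)
  then show ?case using runs_const_gate[of W B] by simp
next
  case (FVar i)
  show ?case
  proof (cases "i < 2")
    case True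
    have "runs (push_num 1 i) (comp_store inp stk W C N, v) (token_time B + token_time B)
        (comp_store inp (encode_nats [i] @ stk) W C N, v)"
      by (rule runs_conv[OF runs_push_num]) (use True in \<open>auto simp: token_time_def\<close>)
    then show ?thesis using True by simp
  next
    case False
    have "runs (push_copy 4 3 1) (comp_store inp stk W C N, v) (token_time B + token_time B)
        (comp_store inp (encode_nats [C] @ stk) W C N, v)"
      by (rule runs_conv[OF runs_push_copy[where k = C]]) (use FVar in \<open>auto simp: token_time_def\<close>)
    then show ?thesis using False by simp
  qed
next
  case (FNot \<phi>)
  show ?case unfolding template.simps
    by (rule runs_conv[OF runs_Seq[OF FNot.IH runs_not_gate[where B = B]]])
      (use FNot.prems in \<open>auto intro!: out_wire_le\<close>)
next
  case (FAnd \<phi> \<psi>)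
  show ?case unfolding template.simps
    by (rule runs_conv[OF runs_Seq[OF FAnd.IH(1) runs_Seq[OF FAnd.IH(2)
          runs_binary_gate[OF _ _ _ _ gate_tokens.simps(3), where B = B]]]])
      (use FAnd.prems in \<open>auto intro!: out_wire_le simp: algebra_simps\<close>)
next
  case (FOr \<phi> \<psi>)
  show ?case unfolding template.simps
    by (rule runs_conv[OF runs_Seq[OF FOr.IH(1) runs_Seq[OF FOr.IH(2)
          runs_binary_gate[OF _ _ _ _ gate_tokens.simps(4), where B = B]]]])
      (use FOr.prems in \<open>auto intro!: out_wire_le simp: algebra_simps\<close>)
qed

text \<open>The 13 consists of one loop test and the decoding of a token, at most
  \<open>2 * 5 + 2\<close>.\<close>

lemma runs_comp_loop_step:
  assumes "runs comp_loop S t S'" "runs p (comp_store inp stk W C N, v) T S"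
    "token_programs ! k = p" "k < 6"
  shows "runs comp_loop (comp_store (encode_nats [k] @ inp) stk W C N, v) (t + (T + 13)) S'"
proof -
  have "runs (dispatch 0 token_programs) (comp_store (encode_nats [k] @ inp) stk W C N, v) (T + 2 * k + 2) S"
    by (rule runs_dispatch[where r = inp]) (use assms(2-) in \<open>auto simp: token_programs_def\<close>)
  moreover have "top_symbol (encode_nats [k] @ inp) \<noteq> 0"
    by (cases k) auto
  ultimately have "runs comp_loop (comp_store (encode_nats [k] @ inp) stk W C N, v) (Suc (T + 2 * k + 2) + t) S'"
    using assms(1) unfolding comp_loop_def by (intro runs_While_step) auto
  then show ?thesis
    by (rule runs_le) (use assms(4) in simp)
qed

text \<open>In continuation form: the loop does not stop after a subformula, so the rest of the run
  is a hypothesis. The induction works backwards, from the operator over the right operand to the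
  left one.\<close>

lemma runs_comp_loop:
  assumes "formula_vars (rename (\<lambda>i. i + 2) \<phi>) \<subseteq> {..B}" "W + gate_count \<phi> \<le> B"
    and "runs comp_loop
      (comp_store inp (encode_nats [out_wire W (rename (\<lambda>i. i + 2) \<phi>)] @ stk) (W + gate_count \<phi>) C N,
       v @ encode_gates (comp_gates W (rename (\<lambda>i. i + 2) \<phi>))) t S'"
  shows "runs comp_loop (comp_store (encode_nats (formula_tokens \<phi>) @ inp) stk W C N, v)
    (t + length (formula_tokens \<phi>) * (token_time B + 13)) S'"
  using assms
proof (induction \<phi> arbitrary: inp stk W v t)
  case (FConst b)
  have "runs (const_gate b) (comp_store inp stk W C N, v) (token_time B)
      (comp_store inp (encode_nats [out_wire W (rename (\<lambda>i. i + 2) (FConst b))] @ stk) (W + gate_count (FConst b)) C N,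
       v @ encode_gates (comp_gates W (rename (\<lambda>i. i + 2) (FConst b))))"
    by (rule runs_conv[OF runs_const_gate[where B = B]]) (use FConst.prems(2) in auto)
  from runs_comp_loop_step[OF FConst.prems(3) this, of "of_bool b"] show ?case
    by (simp add: token_programs_def)
next
  case (FVar i)
  have "runs push_var (comp_store (encode_nats [i] @ inp) stk W C N, v) (token_time B)
      (comp_store inp (encode_nats [out_wire W (rename (\<lambda>i. i + 2) (FVar i))] @ stk) (W + gate_count (FVar i)) C N,
       v @ encode_gates (comp_gates W (rename (\<lambda>i. i + 2) (FVar i))))"
    by (rule runs_conv[OF runs_push_var[where B = B]]) (use FVar.prems(1) in auto)
  from runs_comp_loop_step[OF FVar.prems(3) this, of 2]
  have "runs comp_loop (comp_store (encode_nats (formula_tokens (FVar i)) @ inp) stk W C N, v)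
      (t + (token_time B + 13)) S'"
    by (simp add: token_programs_def)
  then show ?case by (rule runs_le) simp
next
  case (FNot \<phi>)
  let ?r = "rename (\<lambda>i. i + 2)"
  have "runs not_gate (comp_store inp (encode_nats [out_wire W (?r \<phi>)] @ stk) (W + gate_count \<phi>) C N,
        v @ encode_gates (comp_gates W (?r \<phi>))) (token_time B)
      (comp_store inp (encode_nats [out_wire W (?r (FNot \<phi>))] @ stk) (W + gate_count (FNot \<phi>)) C N,
        v @ encode_gates (comp_gates W (?r (FNot \<phi>))))"
    by (rule runs_conv[OF runs_not_gate[where B = B]])
      (use FNot.prems(1,2) in \<open>auto intro!: out_wire_le simp: image_subset_iff\<close>)
  from runs_comp_loop_step[OF FNot.prems(3) this, of 3]
  have "runs comp_loop (comp_store (encode_nats (formula_tokens \<phi>) @ encode_nats [3] @ inp) stk W C N, v)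
      (t + (token_time B + 13) + length (formula_tokens \<phi>) * (token_time B + 13)) S'"
    using FNot.prems(1,2) by (intro FNot.IH) (auto simp: token_programs_def)
  then show ?case
    by (simp add: algebra_simps)
next
  case (FAnd \<phi> \<psi>)
  let ?r = "rename (\<lambda>i. i + 2)" and ?W = "W + gate_count \<phi>"
  let ?a = "out_wire W (?r \<phi>)" and ?b = "out_wire ?W (?r \<psi>)"
  let ?v = "v @ encode_gates (comp_gates W (?r \<phi>)) @ encode_gates (comp_gates ?W (?r \<psi>))"
  have v: "formula_vars (?r \<phi>) \<subseteq> {..B}" "formula_vars (?r \<psi>) \<subseteq> {..B}"
    using FAnd.prems(1) by auto
  have "runs (binary_gate 3) (comp_store inp (encode_nats [?b] @ encode_nats [?a] @ stk) (?W + gate_count \<psi>) C N, ?v)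
      (token_time B) (comp_store inp (encode_nats [out_wire W (?r (FAnd \<phi> \<psi>))] @ stk)
        (W + gate_count (FAnd \<phi> \<psi>)) C N, v @ encode_gates (comp_gates W (?r (FAnd \<phi> \<psi>))))"
    by (rule runs_conv[OF runs_binary_gate[where g = "GAnd ?b ?a" and B = B]])
      (use FAnd.prems(2) v in \<open>auto intro!: out_wire_le simp: algebra_simps image_subset_iff\<close>)
  from runs_comp_loop_step[OF FAnd.prems(3) this, of 4]
  have "runs comp_loop (comp_store (encode_nats (formula_tokens \<psi>) @ encode_nats [4] @ inp)
      (encode_nats [?a] @ stk) ?W C N, v @ encode_gates (comp_gates W (?r \<phi>)))
      (t + (token_time B + 13) + length (formula_tokens \<psi>) * (token_time B + 13)) S'"
    using FAnd.prems(2) v by (intro FAnd.IH(2)) (auto simp: token_programs_def nth_Cons' algebra_simps)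
  from FAnd.IH(1)[OF v(1) _ this]
  have "runs comp_loop (comp_store (encode_nats (formula_tokens \<phi>) @ encode_nats (formula_tokens \<psi>) @
      encode_nats [4] @ inp) stk W C N, v) (t + (token_time B + 13) +
      length (formula_tokens \<psi>) * (token_time B + 13) + length (formula_tokens \<phi>) * (token_time B + 13)) S'"
    using FAnd.prems(2) by simp
  then show ?case
    by (simp add: algebra_simps)
next
  case (FOr \<phi> \<psi>)
  let ?r = "rename (\<lambda>i. i + 2)" and ?W = "W + gate_count \<phi>"
  let ?a = "out_wire W (?r \<phi>)" and ?b = "out_wire ?W (?r \<psi>)"
  let ?v = "v @ encode_gates (comp_gates W (?r \<phi>)) @ encode_gates (comp_gates ?W (?r \<psi>))"
  have v: "formula_vars (?r \<phi>) \<subseteq> {..B}" "formula_vars (?r \<psi>) \<subseteq> {..B}"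
    using FOr.prems(1) by auto
  have "runs (binary_gate 4) (comp_store inp (encode_nats [?b] @ encode_nats [?a] @ stk) (?W + gate_count \<psi>) C N, ?v)
      (token_time B) (comp_store inp (encode_nats [out_wire W (?r (FOr \<phi> \<psi>))] @ stk)
        (W + gate_count (FOr \<phi> \<psi>)) C N, v @ encode_gates (comp_gates W (?r (FOr \<phi> \<psi>))))"
    by (rule runs_conv[OF runs_binary_gate[where g = "GOr ?b ?a" and B = B]])
      (use FOr.prems(2) v in \<open>auto intro!: out_wire_le simp: algebra_simps image_subset_iff\<close>)
  from runs_comp_loop_step[OF FOr.prems(3) this, of 5]
  have "runs comp_loop (comp_store (encode_nats (formula_tokens \<psi>) @ encode_nats [5] @ inp)
      (encode_nats [?a] @ stk) ?W C N, v @ encode_gates (comp_gates W (?r \<phi>)))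
      (t + (token_time B + 13) + length (formula_tokens \<psi>) * (token_time B + 13)) S'"
    using FOr.prems(2) v by (intro FOr.IH(2)) (auto simp: token_programs_def nth_Cons' algebra_simps)
  from FOr.IH(1)[OF v(1) _ this]
  have "runs comp_loop (comp_store (encode_nats (formula_tokens \<phi>) @ encode_nats (formula_tokens \<psi>) @
      encode_nats [5] @ inp) stk W C N, v) (t + (token_time B + 13) +
      length (formula_tokens \<psi>) * (token_time B + 13) + length (formula_tokens \<phi>) * (token_time B + 13)) S'"
    using FOr.prems(2) by simp
  then show ?case
    by (simp add: algebra_simps)
qed

lemma runs_read_size:
  "runs read_size ((\<lambda>_. [])(0 := encode_nats (n # ks)), []) (13 * n + 21)
    (comp_store (encode_nats ks) [] (2 * n + 4) (2 * n + 3) (Suc n), encode_nats [n + 2])"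
proof -
  define inp where "inp = encode_nats ks"
  let ?init = "(\<lambda>_. [])(0 := encode_nats (n # ks))"
  let ?read = "Pop 0 ;; Push 2 True ;; Push 2 True ;; Push 4 True ;; Push 4 True ;; Push 5 True ;; Emit True"
  let ?S = "\<lambda>j. (comp_store (ones (n - j) @ False # inp) [] (2 * j) (2 * j) j, ones j)"
  have "runs ?read (?S j) 12 (?S (Suc j))" if "j < n" for j
  proof -
    have "n - j = Suc (n - Suc j)" using that by simp
    then show ?thesis
      by (intro runs_conv[OF runs_Seq[OF runs_Pop runs_Seq[OF runs_Push runs_Seq[OF runs_Push
          runs_Seq[OF runs_Push runs_Seq[OF runs_Push runs_Seq[OF runs_Push runs_Emit]]]]]]])
        (auto simp: replicate_append_same)
  qed
  then have "runs (while_one 0 ?read) (?S 0) (n * Suc 12 + 1) (?S n)"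
    by (rule runs_while_one[where S = ?S and r = "False # inp"]) auto
  moreover have "?S 0 = (?init, [])"
    by (auto simp: comp_store_def inp_def fun_eq_iff fun_upd_apply)
  ultimately have read: "runs (while_one 0 ?read) (?init, []) (13 * n + 1)
      (comp_store (False # inp) [] (2 * n) (2 * n) n, ones n)"
    by (simp add: mult.commute)
  have e: "encode_nats [n + 2] = ones n @ encode_nats [2]"
    by (simp add: numeral_2_eq_2 ones_snoc)
  have e': "2 * n + 4 = Suc (Suc (Suc (Suc (2 * n))))" "2 * n + 3 = Suc (Suc (Suc (2 * n)))"
    by simp_all
  show ?thesis
    unfolding read_size_def inp_def[symmetric] e e'
    by (rule runs_conv[OF runs_Seq[OF read runs_Seq[OF runs_Pop runs_Seq[OF runs_Push runs_Seq[OF runs_Push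
          runs_Seq[OF runs_Push runs_Seq[OF runs_Push runs_Seq[OF runs_Push runs_Seq[OF runs_Push
          runs_Seq[OF runs_Push runs_Seq[OF runs_Push runs_emit_num]]]]]]]]]]])
      simp_all
qed

lemma runs_game_prog:
  assumes "formula_vars \<psi> \<subseteq> {..<2 * n}"
  shows "runs game_prog ((\<lambda>_. [])(0 := encode_nats (n # formula_tokens \<psi>)), [])
    ((length (formula_tokens \<psi>) + 21) * (token_time (2 * n + length (formula_tokens \<psi>) + 13) + 13) +
      3 * (2 * n + length (formula_tokens \<psi>) + 13) + 16 * n + 50)
    (comp_store [] [] (2 * n + 4 + gate_count (game_formula n \<psi>)) (2 * n + 3) 0,
     encode_nats ((n + 2) # circuit_tokens (game_circuit n \<psi>)))"
proof -
  define L where "L = length (formula_tokens \<psi>)"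
  \<comment> \<open>Bounds all wires, since 13 = 4 + 4 + 3 + 2: inputs beyond \<open>2 * n\<close>,
    gates of the two guards, and the two closing gates.\<close>
  define B where "B = 2 * n + L + 13"
  define C where "C = 2 * n + 3"
  define W0 where "W0 = 2 * n + 4"
  define inp where "inp = encode_nats (formula_tokens \<psi>)"
  define g1 where "g1 = instantiate C guard1"
  define g2 where "g2 = instantiate C guard2"
  define \<psi>' where "\<psi>' = rename (\<lambda>i. i + 2) \<psi>"
  define W1 where "W1 = W0 + gate_count g1"
  define W2 where "W2 = W1 + gate_count g2"
  define W3 where "W3 = W2 + gate_count \<psi>"
  define a1 where "a1 = out_wire W0 g1"
  define a2 where "a2 = out_wire W1 g2"
  define a3 where "a3 = out_wire W2 \<psi>'"
  define v0 where "v0 = encode_nats [n + 2]"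
  define v3 where "v3 = v0 @ encode_gates (comp_gates W0 g1) @ encode_gates (comp_gates W1 g2) @
    encode_gates (comp_gates W2 \<psi>')"
  have gc: "gate_count guard1 = 4" "gate_count guard2 = 3" "gate_count g1 = 4" "gate_count g2 = 3"
    "length (formula_tokens guard1) = 12" "length (formula_tokens guard2) = 7"
    by (simp_all add: g1_def g2_def instantiate_def guard1_def guard2_def)
  have bounds: "W3 + 2 \<le> B" "C \<le> B" "gate_count \<psi> \<le> L"
    using gate_count_le[of \<psi>] gc by (auto simp: W3_def W2_def W1_def W0_def C_def B_def L_def)
  have v1: "formula_vars g1 \<subseteq> {..B}" "formula_vars g2 \<subseteq> {..B}"
    by (auto simp: g1_def g2_def instantiate_def guard1_def guard2_def C_def B_def)
  have v2: "formula_vars \<psi>' \<subseteq> {..B}"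
    using assms unfolding \<psi>'_def B_def formula_vars_rename by fastforce
  have a: "a1 \<le> B" "a2 \<le> B" "a3 \<le> B"
    unfolding a1_def a2_def a3_def using bounds v1 v2
    by (auto intro!: out_wire_le simp: W3_def W2_def W1_def \<psi>'_def image_subset_iff)

  have t0: "runs read_size ((\<lambda>_. [])(0 := encode_nats (n # formula_tokens \<psi>)), []) (13 * n + 21)
      (comp_store inp [] W0 C (Suc n), v0)"
    using runs_read_size[of n "formula_tokens \<psi>"] by (simp add: inp_def W0_def C_def v0_def)
  have t1: "runs (template guard1) (comp_store inp [] W0 C (Suc n), v0) (12 * token_time B)
      (comp_store inp (encode_nats [a1]) W1 C (Suc n), v0 @ encode_gates (comp_gates W0 g1))"
    by (rule runs_conv[OF runs_template[where B = B]])
      (use v1 bounds gc in \<open>auto simp: g1_def a1_def W1_def W2_def W3_def\<close>)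
  have t2: "runs (template guard2) (comp_store inp (encode_nats [a1]) W1 C (Suc n), v0 @ encode_gates (comp_gates W0 g1))
      (7 * token_time B) (comp_store inp (encode_nats [a2, a1]) W2 C (Suc n),
        v0 @ encode_gates (comp_gates W0 g1) @ encode_gates (comp_gates W1 g2))"
    by (rule runs_conv[OF runs_template[where B = B]])
      (use v1 bounds gc in \<open>auto simp: g2_def a2_def W2_def W3_def\<close>)
  have t3: "runs comp_loop (comp_store inp (encode_nats [a2, a1]) W2 C (Suc n),
        v0 @ encode_gates (comp_gates W0 g1) @ encode_gates (comp_gates W1 g2))
      (1 + L * (token_time B + 13)) (comp_store [] (encode_nats [a3, a2, a1]) W3 C (Suc n), v3)"
  proof -
    have "runs comp_loop (comp_store [] (encode_nats [a3, a2, a1]) W3 C (Suc n), v3) 1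
        (comp_store [] (encode_nats [a3, a2, a1]) W3 C (Suc n), v3)"
      unfolding comp_loop_def by (rule runs_While_end) simp
    then have "runs comp_loop (comp_store (encode_nats (formula_tokens \<psi>) @ []) (encode_nats [a2, a1]) W2 C (Suc n),
        v0 @ encode_gates (comp_gates W0 g1) @ encode_gates (comp_gates W1 g2))
      (1 + length (formula_tokens \<psi>) * (token_time B + 13)) (comp_store [] (encode_nats [a3, a2, a1]) W3 C (Suc n), v3)"
      using v2 bounds by (intro runs_comp_loop) (auto simp: \<psi>'_def W3_def v3_def a3_def)
    then show ?thesis by (simp add: inp_def L_def)
  qed
  have t4: "runs (binary_gate 4) (comp_store [] (encode_nats [a3, a2, a1]) W3 C (Suc n), v3) (token_time B)
      (comp_store [] (encode_nats [W3, a1]) (W3 + 1) C (Suc n), v3 @ encode_gates [GOr a3 a2])"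
    using runs_binary_gate[of W3 B a2 a3 4 "GOr a3 a2" "[]" "encode_nats [a1]" C "Suc n" v3] a bounds by simp
  have t5: "runs (binary_gate 3) (comp_store [] (encode_nats [W3, a1]) (W3 + 1) C (Suc n), v3 @ encode_gates [GOr a3 a2])
      (token_time B) (comp_store [] (encode_nats [W3 + 1]) (W3 + 2) C (Suc n), v3 @ encode_gates [GOr a3 a2, GAnd W3 a1])"
    using runs_binary_gate[of "W3 + 1" B a1 W3 3 "GAnd W3 a1" "[]" "[]" C "Suc n"
        "v3 @ encode_gates [GOr a3 a2]"] a bounds by simp
  let ?v = "v3 @ encode_gates [GOr a3 a2, GAnd W3 a1] @ encode_nats [5]"
  have t5': "runs (emit_num 5) (comp_store [] (encode_nats [W3 + 1]) (W3 + 2) C (Suc n),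
      v3 @ encode_gates [GOr a3 a2, GAnd W3 a1]) 6 (comp_store [] (encode_nats [W3 + 1]) (W3 + 2) C (Suc n), ?v)"
    by (rule runs_conv[OF runs_emit_num]) simp_all
  have t6: "runs (emit_pop 1) (comp_store [] (encode_nats [W3 + 1]) (W3 + 2) C (Suc n), ?v) (3 * B + 3)
      (comp_store [] [] (W3 + 2) C (Suc n), ?v @ encode_nats [W3 + 1])"
    by (rule runs_conv[OF runs_emit_pop[where k = "W3 + 1" and r = "[]"]]) (use bounds in auto)
  let ?S = "\<lambda>j. (comp_store [] [] (W3 + 2) C (Suc n - j), ?v @ encode_nats [W3 + 1] @ replicate j False)"
  have "runs (Pop 5 ;; Emit False) (?S j) 2 (?S (Suc j))" if "j < Suc n" for j
  proof -
    have "Suc n - j = Suc (Suc n - Suc j)" using that by simp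
    then show ?thesis
      by (intro runs_conv[OF runs_Seq[OF runs_Pop runs_Emit]]) (auto simp: replicate_append_same)
  qed
  then have "runs (while_one 5 (Pop 5 ;; Emit False)) (?S 0) (Suc n * Suc 2 + 1) (?S (Suc n))"
    by (rule runs_while_one[where S = ?S and r = "[]"]) auto
  from runs_conv[OF this refl, of "3 * n + 4"] have t7: "runs (while_one 5 (Pop 5 ;; Emit False)) (comp_store [] [] (W3 + 2) C (Suc n), ?v @ encode_nats [W3 + 1])
      (3 * n + 4) (comp_store [] [] (W3 + 2) C 0, ?v @ encode_nats [W3 + 1] @ replicate (Suc n) False)"
    by simp
  have zeros: "encode_nats (replicate k 0) = replicate k False" for k
    by (induction k) auto
  have game: "game_formula n \<psi> = FAnd g1 (FOr g2 \<psi>')"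
    by (simp add: game_formula_def g1_def g2_def \<psi>'_def C_def)
  have "gate_count \<psi>' = gate_count \<psi>"
    by (simp add: \<psi>'_def)
  then have gates: "comp_gates W0 (game_formula n \<psi>) = comp_gates W0 g1 @ comp_gates W1 g2 @ comp_gates W2 \<psi>' @
      [GOr a3 a2, GAnd W3 a1]" and wire: "out_wire W0 (game_formula n \<psi>) = W3 + 1"
    and W: "2 * n + 4 + gate_count (game_formula n \<psi>) = W3 + 2"
    unfolding game by (simp_all add: W3_def W2_def W1_def W0_def a1_def a2_def a3_def add.assoc)
  have out: "encode_nats ((n + 2) # circuit_tokens (game_circuit n \<psi>)) =
      ?v @ encode_nats [W3 + 1] @ replicate (Suc n) False"
    using zeros[of "n + 1"] unfolding circuit_tokens_def game_circuit_def W0_def[symmetric] gates wire v3_def v0_def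
    by simp
  \<comment> \<open>The factor \<open>L + 21\<close> counts tokens: 12 and 7 in the guards, two
    closing gates, and \<open>L\<close> in \<open>\<psi>\<close>.\<close>
  have "13 * n + 21 + (12 * token_time B + (7 * token_time B + (1 + L * (token_time B + 13) + (token_time B +
      (token_time B + (6 + (3 * B + 3 + (3 * n + 4)))))))) \<le> (L + 21) * (token_time B + 13) + 3 * B + 16 * n + 50"
    by (simp add: algebra_simps)
  then show ?thesis
    unfolding game_prog_def out W C_def[symmetric] L_def[symmetric] B_def[symmetric]
    by (rule runs_le[OF runs_Seq[OF t0 runs_Seq[OF t1 runs_Seq[OF t2 runs_Seq[OF t3 runs_Seq[OF t4
      runs_Seq[OF t5 runs_Seq[OF t5' runs_Seq[OF t6 t7]]]]]]]]])
qed

theorem UEA_Sat_reducible: "UEA_Sat \<le>\<^sub>p WDom_Strategy"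
  unfolding poly_time_reducible_def
proof (intro exI conjI allI impI)
  let ?f = "\<lambda>(n, \<psi>). (n + 2, game_circuit n \<psi>)"
  \<comment> \<open>With \<open>2 * n + L\<close> replaced by \<open>2 * K\<close>, the time bound
    is \<open>32 * K^2 + 935 * K + 5150\<close>; the coefficients are rounded up.\<close>
  let ?p = "[:6000, 1000, 32:] :: nat poly"
  show "tm_wf (compile game_prog)" by (rule tm_wf_compile)
  fix a :: "nat \<times> formula"
  assume inst: "is_instance UEA_Sat a"
  obtain n \<psi> where a: "a = (n, \<psi>)" by (cases a)
  show "is_instance WDom_Strategy (?f a)" "is_yes UEA_Sat a \<longleftrightarrow> is_yes WDom_Strategy (?f a)"
    using is_instance_game[of n \<psi>] is_yes_game[of n \<psi>] inst unfolding a by simp_all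
  define K where "K = length (encode UEA_Sat a)"
  define L where "L = length (formula_tokens \<psi>)"
  have e: "encode UEA_Sat a = encode_nats (n # formula_tokens \<psi>)"
    "encode WDom_Strategy (?f a) = encode_nats ((n + 2) # circuit_tokens (game_circuit n \<psi>))"
    by (simp_all add: a UEA_Sat_def WDom_Strategy_def)
  have "n + L \<le> K"
    unfolding K_def L_def e by (simp add: length_encode_nats)
  then have "(L + 21) * (token_time (2 * n + L + 13) + 13) + 3 * (2 * n + L + 13) + 16 * n + 50
      \<le> (K + 21) * (token_time (2 * K + 13) + 13) + 3 * (2 * K + 13) + 16 * K + 50"
    by (intro add_mono mult_mono) (simp_all add: token_time_def)
  also have "\<dots> \<le> poly ?p K"
    by (simp add: token_time_def algebra_simps)
  finally have "runs game_prog ((\<lambda>_. [])(0 := encode UEA_Sat a), []) (poly ?p K)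
      (comp_store [] [] (2 * n + 4 + gate_count (game_formula n \<psi>)) (2 * n + 3) 0, encode WDom_Strategy (?f a))"
    unfolding e L_def using inst by (intro runs_le[OF runs_game_prog]) (simp add: a UEA_Sat_def)
  then show "computes_within (compile game_prog) (encode UEA_Sat a) (encode WDom_Strategy (?f a))
      (poly ?p (length (encode UEA_Sat a)))"
    unfolding K_def by (rule runs_computes_within)
qed

section \<open>Reducing \<open>WDom_Strategy\<close> to \<open>UEA_Sat\<close>\<close>

lemma gate_eval_cong: "(\<And>i. i \<in> gate_wires g \<Longrightarrow> ws ! i = ws' ! i) \<Longrightarrow> gate_eval ws g = gate_eval ws' g"
  by (cases g) auto

text \<open>A gate reads only earlier wires, and these never change afterwards, so its equation
  still holds in the completed list.\<close>

lemma wires_gate: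
  "(\<And>j i. j < length gs \<Longrightarrow> i \<in> gate_wires (gs ! j) \<Longrightarrow> i < length z + j) \<Longrightarrow> j < length gs \<Longrightarrow>
    wires gs z ! (length z + j) = gate_eval (wires gs z) (gs ! j)"
proof (induction gs arbitrary: z j)
  case (Cons g gs)
  let ?z = "z @ [gate_eval z g]"
  show ?case
  proof (cases j)
    case 0
    have "gate_eval (wires gs ?z) g = gate_eval z g"
      using Cons.prems(1)[of 0] by (intro gate_eval_cong) (simp add: nth_wires nth_append less_SucI)
    then show ?thesis using 0 nth_wires[of "length z" ?z gs] by simp
  next
    case (Suc k)
    have "wires gs ?z ! (length ?z + k) = gate_eval (wires gs ?z) (gs ! k)"
      using Cons.prems(2) Suc Cons.prems(1)[of "Suc _"] by (intro Cons.IH) auto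
    then show ?thesis using Suc by simp
  qed
qed simp

text \<open>In topological order each equation determines the next wire from the previous ones.
  Hence local checks recognise a correct evaluation, which is what the formula relies on.\<close>

lemma wires_unique:
  "length ws = m + length gs \<Longrightarrow>
    (\<And>j i. j < length gs \<Longrightarrow> i \<in> gate_wires (gs ! j) \<Longrightarrow> i < m + j) \<Longrightarrow>
    (\<And>j. j < length gs \<Longrightarrow> ws ! (m + j) = gate_eval ws (gs ! j)) \<Longrightarrow> wires gs (take m ws) = ws"
proof (induction gs arbitrary: m)
  case (Cons g gs)
  have "gate_eval (take m ws) g = gate_eval ws g"
    using Cons.prems(2)[of 0] by (intro gate_eval_cong) auto
  then have "take m ws @ [gate_eval (take m ws) g] = take (Suc m) ws"
    using Cons.prems(1) Cons.prems(3)[of 0] by (simp add: take_Suc_conv_app_nth)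
  moreover have "wires gs (take (Suc m) ws) = ws"
    using Cons.prems(1) Cons.prems(2)[of "Suc _"] Cons.prems(3)[of "Suc _"] by (intro Cons.IH) auto
  ultimately show ?case by simp
qed simp

definition xor_formula :: "formula \<Rightarrow> formula \<Rightarrow> formula" where
  "xor_formula \<phi> \<psi> = FOr (FAnd \<phi> (FNot \<psi>)) (FAnd (FNot \<phi>) \<psi>)"

fun gate_formula :: "(nat \<Rightarrow> nat) \<Rightarrow> gate \<Rightarrow> formula" where
  "gate_formula w (GConst b) = FConst b"
| "gate_formula w (GNot i) = FNot (FVar (w i))"
| "gate_formula w (GAnd i j) = FAnd (FVar (w i)) (FVar (w j))"
| "gate_formula w (GOr i j) = FOr (FVar (w i)) (FVar (w j))"

text \<open>Both copies are tested in one formula, so the machine needs to read each gate only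
  once.\<close>

definition clash :: "(nat \<Rightarrow> nat) \<Rightarrow> (nat \<Rightarrow> nat) \<Rightarrow> nat \<Rightarrow> gate \<Rightarrow> formula" where
  "clash u v a g = FOr (xor_formula (FVar (u a)) (gate_formula u g)) (xor_formula (FVar (v a)) (gate_formula v g))"

fun clashes :: "(nat \<Rightarrow> nat) \<Rightarrow> (nat \<Rightarrow> nat) \<Rightarrow> nat \<Rightarrow> gate list \<Rightarrow> formula list" where
  "clashes u v a [] = []"
| "clashes u v a (g # gs) = clash u v a g # clashes u v (Suc a) gs"

fun ge_formula :: "(nat \<Rightarrow> nat) \<Rightarrow> (nat \<Rightarrow> nat) \<Rightarrow> nat list \<Rightarrow> formula" where
  "ge_formula u v [] = FConst True"
| "ge_formula u v (i # is) = FOr (FAnd (FVar (u i)) (FNot (FVar (v i))))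
     (FAnd (FOr (FVar (u i)) (FNot (FVar (v i)))) (ge_formula u v is))"

text \<open>
  The universally quantified variables hold the wires of two copies of the circuit, which evaluate
  the strategy \<open>x\<close> and a competitor against the same \<open>y\<close>. Their values are interleaved, starting at
  index \<open>N\<close>.
\<close>
definition wire1 :: "nat \<Rightarrow> nat \<Rightarrow> nat" where
  "wire1 N i = N + 2 * i"

text \<open>Interleaving makes both indices depend on \<open>N\<close> and \<open>i\<close> only;
  with one copy after the other, the number of gates would be needed before the gates have been
  read.\<close>

definition wire2 :: "nat \<Rightarrow> nat \<Rightarrow> nat" where
  "wire2 N i = N + 2 * i + 1"

text \<open>The first \<open>n\<close> inputs of the second copy are left free: they are the
  competitor. The inputs from \<open>n\<close> on are only required to agree in both copies: they
  are the common \<open>y\<close>.\<close>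

definition violations :: "nat \<Rightarrow> nat \<Rightarrow> circuit \<Rightarrow> formula list" where
  "violations N n C = map (\<lambda>i. xor_formula (FVar (wire1 N i)) (FVar i)) [0..<n] @
     map (\<lambda>i. xor_formula (FVar (wire1 N i)) (FVar (wire2 N i))) [n..<2 * n] @
     clashes (wire1 N) (wire2 N) (2 * n) (gates C)"

text \<open>Nesting to the left puts each operator directly behind its item in reverse Polish
  notation, so items are printed as they are found. The padding stands outside the implication
  because it has to hold whatever the wires are.\<close>

definition dominance_formula :: "nat \<Rightarrow> nat \<Rightarrow> circuit \<Rightarrow> formula" where
  "dominance_formula N n C =
     FAnd (foldl (\<lambda>\<phi> i. FAnd \<phi> (FNot (FVar i))) (FConst True) [n..<N])
       (FOr (foldl FOr (FConst False) (violations N n C)) (ge_formula (wire1 N) (wire2 N) (outputs C)))"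

section \<open>Semantics and variables of the dominance formula\<close>

lemma formula_eval_xor [simp]:
  "formula_eval (xor_formula \<phi> \<psi>) z \<longleftrightarrow> formula_eval \<phi> z \<noteq> formula_eval \<psi> z"
  by (auto simp: xor_formula_def)

lemma formula_eval_gate_formula:
  "(\<And>i. i \<in> gate_wires g \<Longrightarrow> z ! w i = ws ! i) \<Longrightarrow> formula_eval (gate_formula w g) z = gate_eval ws g"
  by (cases g) auto

lemma formula_eval_foldl_FOr:
  "formula_eval (foldl FOr \<phi> \<phi>s) z \<longleftrightarrow> formula_eval \<phi> z \<or> (\<exists>\<psi> \<in> set \<phi>s. formula_eval \<psi> z)"
  by (induction \<phi>s arbitrary: \<phi>) auto

lemma formula_eval_padding:
  "formula_eval (foldl (\<lambda>\<phi> i. FAnd \<phi> (FNot (FVar i))) \<phi> is) z \<longleftrightarrow>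
    formula_eval \<phi> z \<and> (\<forall>i \<in> set is. \<not> z ! i)"
  by (induction "is" arbitrary: \<phi>) auto

lemma formula_eval_ge:
  "formula_eval (ge_formula u v is) z \<longleftrightarrow>
    binary_value (map (\<lambda>i. z ! v i) is) \<le> binary_value (map (\<lambda>i. z ! u i) is)"
  by (induction "is") (auto simp: binary_value_Cons_le)

lemma set_clashes: "set (clashes u v a gs) = (\<lambda>j. clash u v (a + j) (gs ! j)) ` {..<length gs}"
proof (induction gs arbitrary: a)
  case (Cons g gs)
  show ?case
    by (auto simp: Cons lessThan_Suc_eq_insert_0 image_image)
qed simp

lemma formula_vars_foldl_FOr:
  "formula_vars (foldl FOr \<phi> \<phi>s) = formula_vars \<phi> \<union> (\<Union>\<psi> \<in> set \<phi>s. formula_vars \<psi>)"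
  by (induction \<phi>s arbitrary: \<phi>) auto

lemma formula_vars_padding:
  "formula_vars (foldl (\<lambda>\<phi> i. FAnd \<phi> (FNot (FVar i))) \<phi> is) = formula_vars \<phi> \<union> set is"
  by (induction "is" arbitrary: \<phi>) auto

lemma formula_vars_ge: "formula_vars (ge_formula u v is) = u ` set is \<union> v ` set is"
  by (induction "is") auto

lemma formula_vars_gate_formula: "formula_vars (gate_formula w g) = w ` gate_wires g"
  by (cases g) auto

text \<open>Two copies of all wires have to fit into the \<open>N\<close> universal variables.
  Leaving \<open>N\<close> otherwise open admits twice the length of the encoded input, which a
  machine can count without parsing.\<close>

context
  fixes N n :: nat and C :: circuit
  assumes circuit: "is_circuit (2 * n) n C" and N: "2 * (2 * n + length (gates C)) \<le> N"
begin

lemma gate_wires_bound: "j < length (gates C) \<Longrightarrow> i \<in> gate_wires (gates C ! j) \<Longrightarrow> i < 2 * n + j"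
  using circuit by (auto simp: is_circuit_def)

lemma outputs_bound: "i \<in> set (outputs C) \<Longrightarrow> i < 2 * n + length (gates C)"
  using circuit by (auto simp: is_circuit_def)

lemma is_instance_dominance: "is_instance UEA_Sat (N, dominance_formula N n C)"
proof -
  have "formula_vars \<psi> \<subseteq> {..<2 * N}" if "\<psi> \<in> set (violations N n C)" for \<psi>
    using that gate_wires_bound N
    by (fastforce simp: violations_def set_clashes clash_def xor_formula_def formula_vars_gate_formula
        wire1_def wire2_def)
  moreover have "formula_vars (ge_formula (wire1 N) (wire2 N) (outputs C)) \<subseteq> {..<2 * N}"
    using outputs_bound N by (fastforce simp: formula_vars_ge wire1_def wire2_def)
  ultimately show ?thesis
    by (auto simp: UEA_Sat_def dominance_formula_def formula_vars_foldl_FOr formula_vars_padding)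
qed

lemma no_violation:
  fixes X Y :: "bool list"
  assumes "length X = N"
  defines "W \<equiv> 2 * n + length (gates C)"
  defines "us \<equiv> map (\<lambda>i. (X @ Y) ! wire1 N i) [0..<W]" and "vs \<equiv> map (\<lambda>i. (X @ Y) ! wire2 N i) [0..<W]"
  shows "(\<forall>\<psi> \<in> set (violations N n C). \<not> formula_eval \<psi> (X @ Y)) \<longleftrightarrow>
    take n us = take n X \<and> take n (drop n us) = take n (drop n vs) \<and>
    (\<forall>j < length (gates C). us ! (2 * n + j) = gate_eval us (gates C ! j) \<and>
      vs ! (2 * n + j) = gate_eval vs (gates C ! j))"
proof -
  have [simp]: "i < W \<Longrightarrow> us ! i = (X @ Y) ! wire1 N i" "i < W \<Longrightarrow> vs ! i = (X @ Y) ! wire2 N i" for i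
    by (auto simp: us_def vs_def)
  have W: "n \<le> W" "2 * n \<le> W" "n \<le> N" "length us = W" "length vs = W"
    using N by (auto simp: W_def us_def vs_def)
  have 1: "(\<forall>i \<in> {0..<n}. \<not> formula_eval (xor_formula (FVar (wire1 N i)) (FVar i)) (X @ Y)) \<longleftrightarrow> take n us = take n X"
    using W assms(1) by (auto simp: list_eq_iff_nth_eq nth_append)
  have 2: "(\<forall>i \<in> {n..<2 * n}. \<not> formula_eval (xor_formula (FVar (wire1 N i)) (FVar (wire2 N i))) (X @ Y)) \<longleftrightarrow>
      take n (drop n us) = take n (drop n vs)" (is "?L \<longleftrightarrow> ?R")
  proof -
    have "?R \<longleftrightarrow> (\<forall>i < n. (X @ Y) ! wire1 N (n + i) = (X @ Y) ! wire2 N (n + i))"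
      using W by (simp add: list_eq_iff_nth_eq)
    also have "\<dots> \<longleftrightarrow> ?L"
      by (auto simp: le_iff_add)
    finally show ?thesis by simp
  qed
  have 3: "formula_eval (clash (wire1 N) (wire2 N) (2 * n + j) (gates C ! j)) (X @ Y) \<longleftrightarrow>
      \<not> (us ! (2 * n + j) = gate_eval us (gates C ! j) \<and> vs ! (2 * n + j) = gate_eval vs (gates C ! j))"
    if "j < length (gates C)" for j
  proof -
    have "formula_eval (gate_formula (wire1 N) (gates C ! j)) (X @ Y) = gate_eval us (gates C ! j)"
      "formula_eval (gate_formula (wire2 N) (gates C ! j)) (X @ Y) = gate_eval vs (gates C ! j)"
      using gate_wires_bound[OF that] that
      by (intro formula_eval_gate_formula; force simp: W_def)+
    then show ?thesis using that by (simp add: clash_def W_def)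
  qed
  show ?thesis
    unfolding 1[symmetric] 2[symmetric] using 3
    by (simp add: violations_def set_clashes ball_Un lessThan_iff Ball_def[of "{..<_}"])
qed

lemma dominance_formula_eval:
  assumes X: "length X = N"
  shows "(\<forall>Y \<in> bit_strings N. formula_eval (dominance_formula N n C) (X @ Y)) \<longleftrightarrow>
    (\<forall>i \<in> {n..<N}. \<not> X ! i) \<and> (\<forall>x' \<in> bit_strings n. \<forall>y \<in> bit_strings n.
      binary_value (circuit_eval C (x' @ y)) \<le> binary_value (circuit_eval C (take n X @ y)))"
    (is "?L \<longleftrightarrow> ?pad \<and> ?opt")
proof -
  define W where "W = 2 * n + length (gates C)"
  define us where "us Y = map (\<lambda>i. (X @ Y) ! wire1 N i) [0..<W]" for Y
  define vs where "vs Y = map (\<lambda>i. (X @ Y) ! wire2 N i) [0..<W]" for Y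
  let ?ok = "\<lambda>Y. \<forall>\<psi> \<in> set (violations N n C). \<not> formula_eval \<psi> (X @ Y)"
  note ok = no_violation[OF X, folded W_def, folded us_def vs_def]
  have W: "n \<le> W" "2 * n \<le> W" "2 * W \<le> N" "n \<le> N" "length (us Y) = W" "length (vs Y) = W" for Y
    using N by (auto simp: W_def us_def vs_def)
  have pad: "(\<forall>i \<in> set [n..<N]. \<not> (X @ Y) ! i) \<longleftrightarrow> ?pad" for Y
    using X by (auto simp: nth_append)
  have eval: "formula_eval (dominance_formula N n C) (X @ Y) \<longleftrightarrow>
      ?pad \<and> (?ok Y \<longrightarrow> binary_value (map ((!) (vs Y)) (outputs C)) \<le> binary_value (map ((!) (us Y)) (outputs C)))" for Y
  proof -
    have maps: "map (\<lambda>i. (X @ Y) ! wire1 N i) (outputs C) = map ((!) (us Y)) (outputs C)"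
      "map (\<lambda>i. (X @ Y) ! wire2 N i) (outputs C) = map ((!) (vs Y)) (outputs C)"
      using outputs_bound by (auto simp: us_def vs_def W_def)
    then show ?thesis
      unfolding dominance_formula_def formula_eval.simps formula_eval_padding pad formula_eval_foldl_FOr formula_eval_ge maps
      by auto
  qed
  show ?thesis
  proof
    assume L: ?L
    \<comment> \<open>The padding conjunct concerns \<open>X\<close> alone, so a single
      \<open>Y\<close> reveals it.\<close>
    have "replicate N False \<in> bit_strings N" by (simp add: bit_strings_def)
    then have ?pad using L eval by blast
    moreover have "binary_value (circuit_eval C (x' @ y)) \<le> binary_value (circuit_eval C (take n X @ y))"
      if "length x' = n" "length y = n" for x' y
    proof -
      define ws1 where "ws1 = wires (gates C) (take n X @ y)"
      define ws2 where "ws2 = wires (gates C) (x' @ y)"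
      \<comment> \<open>Even positions carry the evaluation for the strategy, odd ones that for the
        competitor; positions from \<open>2 * W\<close> on default to \<open>False\<close>.\<close>
      define Y where "Y = map (\<lambda>k. k < 2 * W \<and> (if even k then ws1 else ws2) ! (k div 2)) [0..<N]"
      have len: "length ws1 = W" "length ws2 = W" "length Y = N"
        using that X W by (auto simp: ws1_def ws2_def W_def Y_def)
      have us: "us Y = ws1" and vs: "vs Y = ws2"
        using W X by (auto simp: us_def vs_def list_eq_iff_nth_eq len wire1_def wire2_def nth_append Y_def)
      have gate: "wires (gates C) (x @ y) ! (2 * n + j) = gate_eval (wires (gates C) (x @ y)) (gates C ! j)"
        if "length x = n" "j < length (gates C)" for x j
        using wires_gate[of "gates C" "x @ y" j] gate_wires_bound that \<open>length y = n\<close> by (simp add: mult_2)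
      have "take n ws1 = take n X" "take n (drop n ws1) = y" "take n (drop n ws2) = y"
        using X W that len
        by (auto simp: list_eq_iff_nth_eq ws1_def ws2_def nth_wires nth_append)
      then have "?ok Y"
        unfolding ok us vs using gate[of "take n X"] gate[of x'] X W that by (simp add: ws1_def ws2_def)
      moreover have "Y \<in> bit_strings N" using len by (simp add: bit_strings_def)
      ultimately have "binary_value (map ((!) ws2) (outputs C)) \<le> binary_value (map ((!) ws1) (outputs C))"
        using L eval[of Y] unfolding us vs by blast
      then show ?thesis
        by (simp add: circuit_eval_wires ws1_def ws2_def)
    qed
    ultimately show "?pad \<and> ?opt" by (simp add: bit_strings_def)
  next
    assume R: "?pad \<and> ?opt"
    show ?L
    proof
      fix Y assume "Y \<in> bit_strings N"
      show "formula_eval (dominance_formula N n C) (X @ Y)"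
        unfolding eval
      proof (intro conjI impI)
        show ?pad using R by simp
        assume "?ok Y"
        then have 1: "take n (us Y) = take n X" "take n (drop n (us Y)) = take n (drop n (vs Y))"
          and 2: "wires (gates C) (take (2 * n) (us Y)) = us Y" "wires (gates C) (take (2 * n) (vs Y)) = vs Y"
          unfolding ok using gate_wires_bound W by (auto intro!: wires_unique simp: W_def)
        \<comment> \<open>Competitor and opponent are read off the inputs of the second copy; the
          first copy agrees with it on the opponent's part.\<close>
        let ?y = "take n (drop n (vs Y))" and ?x = "take n (vs Y)"
        have "take (2 * n) (us Y) = take n X @ ?y" "take (2 * n) (vs Y) = ?x @ ?y"
          using 1 by (simp_all add: mult_2 take_add)
        then have "circuit_eval C (take n X @ ?y) = map ((!) (us Y)) (outputs C)"
          "circuit_eval C (?x @ ?y) = map ((!) (vs Y)) (outputs C)"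
          using 2 by (simp_all add: circuit_eval_wires)
        moreover have "?x \<in> bit_strings n" "?y \<in> bit_strings n"
          using W by (simp_all add: bit_strings_def)
        ultimately show "binary_value (map ((!) (vs Y)) (outputs C)) \<le> binary_value (map ((!) (us Y)) (outputs C))"
          using R by metis
      qed
    qed
  qed
qed

lemma is_yes_dominance:
  "is_yes WDom_Strategy (n, C) \<longleftrightarrow> is_yes UEA_Sat (N, dominance_formula N n C)"
proof -
  define P where "P x \<longleftrightarrow> (\<forall>x' \<in> bit_strings n. \<forall>y \<in> bit_strings n.
    binary_value (circuit_eval C (x' @ y)) \<le> binary_value (circuit_eval C (x @ y)))" for x
  have nN: "n \<le> N" using N by simp
  \<comment> \<open>Padding makes \<open>X\<close> a function of its first \<open>n\<close> bits, so
    uniqueness carries over in both directions.\<close>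
  have split: "X \<in> bit_strings N \<and> (\<forall>i \<in> {n..<N}. \<not> X ! i) \<longleftrightarrow>
      (\<exists>x. x \<in> bit_strings n \<and> X = x @ replicate (N - n) False)" for X
  proof
    assume X: "X \<in> bit_strings N \<and> (\<forall>i \<in> {n..<N}. \<not> X ! i)"
    then have "X = take n X @ replicate (N - n) False"
      using nN by (intro nth_equalityI) (auto simp: bit_strings_def nth_append)
    then show "\<exists>x. x \<in> bit_strings n \<and> X = x @ replicate (N - n) False"
      using X nN by (intro exI[of _ "take n X"]) (auto simp: bit_strings_def)
  qed (use nN in \<open>auto simp: bit_strings_def nth_append\<close>)
  have "is_yes UEA_Sat (N, dominance_formula N n C) \<longleftrightarrow>
      (\<exists>!X. X \<in> bit_strings N \<and> (\<forall>Y \<in> bit_strings N. formula_eval (dominance_formula N n C) (X @ Y)))"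
    by (simp add: UEA_Sat_def)
  also have "\<dots> \<longleftrightarrow> (\<exists>!X. (X \<in> bit_strings N \<and> (\<forall>i \<in> {n..<N}. \<not> X ! i)) \<and> P (take n X))"
  proof (intro arg_cong[where f = Ex1] ext)
    show "X \<in> bit_strings N \<and> (\<forall>Y \<in> bit_strings N. formula_eval (dominance_formula N n C) (X @ Y)) \<longleftrightarrow>
        (X \<in> bit_strings N \<and> (\<forall>i \<in> {n..<N}. \<not> X ! i)) \<and> P (take n X)" for X
      using dominance_formula_eval[of X] unfolding P_def bit_strings_def by auto
  qed
  also have "\<dots> \<longleftrightarrow> (\<exists>!X. \<exists>x. x \<in> bit_strings n \<and> P x \<and> X = x @ replicate (N - n) False)"
    unfolding split by (intro arg_cong[where f = Ex1] ext) (auto simp: bit_strings_def)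
  also have "\<dots> \<longleftrightarrow> (\<exists>!x. x \<in> bit_strings n \<and> P x)"
    by auto
  finally show ?thesis
    unfolding is_yes_WDom P_def by simp
qed

end

text \<open>
  Register 1 holds \<open>N\<close>, register 3 the number of padding variables still to be forced to be
  false, register 4 the next one of these, register 5 the next wire, registers 6 and 7 the arguments
  of a gate, registers 8, 9 and 10 loop counters for the inputs and outputs; register 11 is empty
  once all gates have been read, and register 2 is scratch space.
\<close>
definition dom_store :: "nat \<Rightarrow> bool list \<Rightarrow> nat \<Rightarrow> nat \<Rightarrow> nat \<Rightarrow> nat \<Rightarrow> nat \<Rightarrow> nat \<Rightarrow> nat \<Rightarrow> nat \<Rightarrow> nat
    \<Rightarrow> nat \<Rightarrow> bool list" where
  "dom_store N inp R B A I J a b c F = (\<lambda>_. [])(0 := inp, 1 := ones N, 3 := ones R, 4 := ones B,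
     5 := ones A, 6 := ones I, 7 := ones J, 8 := ones a, 9 := ones b, 10 := ones c, 11 := ones F)"

lemma dom_store_nth [simp]:
  "dom_store N inp R B A I J a b c F 0 = inp"
  "dom_store N inp R B A I J a b c F (Suc 0) = ones N"
  "dom_store N inp R B A I J a b c F 2 = []"
  "dom_store N inp R B A I J a b c F 3 = ones R"
  "dom_store N inp R B A I J a b c F 4 = ones B"
  "dom_store N inp R B A I J a b c F 5 = ones A"
  "dom_store N inp R B A I J a b c F 6 = ones I"
  "dom_store N inp R B A I J a b c F 7 = ones J"
  "dom_store N inp R B A I J a b c F 8 = ones a"
  "dom_store N inp R B A I J a b c F 9 = ones b"
  "dom_store N inp R B A I J a b c F 10 = ones c"
  "dom_store N inp R B A I J a b c F 11 = ones F"
  by (auto simp: dom_store_def fun_upd_apply)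

lemma dom_store_upd [simp]:
  "(dom_store N inp R B A I J a b c F)(0 := inp') = dom_store N inp' R B A I J a b c F"
  "False \<notin> set xs \<Longrightarrow> (dom_store N inp R B A I J a b c F)(3 := xs) = dom_store N inp (length xs) B A I J a b c F"
  "False \<notin> set xs \<Longrightarrow> (dom_store N inp R B A I J a b c F)(4 := xs) = dom_store N inp R (length xs) A I J a b c F"
  "False \<notin> set xs \<Longrightarrow> (dom_store N inp R B A I J a b c F)(5 := xs) = dom_store N inp R B (length xs) I J a b c F"
  "False \<notin> set xs \<Longrightarrow> (dom_store N inp R B A I J a b c F)(6 := xs) = dom_store N inp R B A (length xs) J a b c F"
  "False \<notin> set xs \<Longrightarrow> (dom_store N inp R B A I J a b c F)(7 := xs) = dom_store N inp R B A I (length xs) a b c F"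
  "False \<notin> set xs \<Longrightarrow> (dom_store N inp R B A I J a b c F)(8 := xs) = dom_store N inp R B A I J (length xs) b c F"
  "False \<notin> set xs \<Longrightarrow> (dom_store N inp R B A I J a b c F)(9 := xs) = dom_store N inp R B A I J a (length xs) c F"
  "False \<notin> set xs \<Longrightarrow> (dom_store N inp R B A I J a b c F)(10 := xs) = dom_store N inp R B A I J a b (length xs) F"
  "False \<notin> set xs \<Longrightarrow> (dom_store N inp R B A I J a b c F)(11 := xs) = dom_store N inp R B A I J a b c (length xs)"
  by (auto simp: dom_store_def fun_upd_apply fun_eq_iff ones_if_no_False[symmetric])

text \<open>With \<open>d\<close> set, each unit is printed twice, which yields the summand
  \<open>2 * i\<close> of a wire index.\<close>

definition emit_copy :: "bool \<Rightarrow> nat \<Rightarrow> prog" where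
  "emit_copy d i = while_one i (Pop i ;; Push 2 True ;; (if d then Emit True ;; Emit True else Emit True)) ;;
     move 2 i"

lemma runs_emit_copy:
  assumes "s i = ones k" "s 2 = []" "i \<noteq> 2"
  shows "runs (emit_copy d i) (s, w) (10 * k + 2) (s, w @ ones ((if d then 2 else 1) * k))"
proof -
  let ?d = "if d then 2 else 1 :: nat"
  let ?S = "\<lambda>l. (s(i := ones (k - l), 2 := ones l), w @ ones (?d * l))"
  have emit: "runs (if d then Emit True ;; Emit True else Emit True) (s', w') 2 (s', w' @ ones ?d)" for s' w'
  proof (cases d)
    case True
    have "runs (Emit True ;; Emit True) (s', w') 2 (s', w' @ ones 2)"
      by (rule runs_conv[OF runs_Seq[OF runs_Emit runs_Emit]]) (simp_all add: numeral_2_eq_2)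
    then show ?thesis using True by simp
  next
    case False
    have "runs (Emit True) (s', w') 2 (s', w' @ ones 1)"
      by (rule runs_conv[OF runs_Emit]) simp_all
    then show ?thesis using False by simp
  qed
  have *: "runs (Pop i ;; Push 2 True ;; (if d then Emit True ;; Emit True else Emit True)) (?S l) 5 (?S (Suc l))"
    if "l < k" for l
  proof (rule runs_conv[OF runs_Seq[OF runs_Pop runs_Seq[OF runs_Push emit]]])
    have "k - l = Suc (k - Suc l)" using that by simp
    moreover have "ones (?d * l) @ ones ?d = ones (?d * Suc l)"
      by (simp flip: replicate_add)
    ultimately show "((s(i := ones (k - l), 2 := ones l))(i := tl ((s(i := ones (k - l), 2 := ones l)) i),
        2 := True # ((s(i := ones (k - l), 2 := ones l))(i := tl ((s(i := ones (k - l), 2 := ones l)) i))) 2),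
        (w @ ones (?d * l)) @ ones ?d) = ?S (Suc l)"
      using assms(3) by (simp add: fun_eq_iff fun_upd_apply del: mult_Suc_right)
  qed simp
  have **: "runs (while_one i (Pop i ;; Push 2 True ;; (if d then Emit True ;; Emit True else Emit True)))
      (?S 0) (k * Suc 5 + 1) (?S k)"
    by (rule runs_while_one[where S = ?S and r = "[]", OF *]) (use assms in auto)
  have "runs (move 2 i) (?S k) (4 * k + 1) (s, w @ ones (?d * k))"
    using assms by (intro runs_conv[OF runs_move[where k = k and r = "[]"]]) (auto simp: fun_eq_iff fun_upd_apply)
  moreover have e: "?S 0 = (s, w)" using assms by (auto simp: fun_eq_iff fun_upd_apply)
  ultimately show ?thesis
    unfolding emit_copy_def by (intro runs_le[OF runs_Seq[OF **[unfolded e]]]) (assumption, simp)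
qed

text \<open>
  In a template, variable \<open>3 * r + d\<close> stands for the variable whose index is the number in register
  \<open>r\<close> (\<open>d = 0\<close>), or for the value of the wire with this number in copy \<open>d\<close> of the circuit.
\<close>
definition var_index :: "(nat \<Rightarrow> bool list) \<Rightarrow> nat \<Rightarrow> nat" where
  "var_index s k = (if k mod 3 = 0 then length (s (k div 3))
     else length (s 1) + 2 * length (s (k div 3)) + (k mod 3 - 1))"

definition copy1 :: "nat \<Rightarrow> nat" where
  "copy1 r = 3 * r + 1"

definition copy2 :: "nat \<Rightarrow> nat" where
  "copy2 r = 3 * r + 2"

text \<open>Addition in unary is concatenation: \<open>N\<close> ones, then twice the wire number,
  and \<open>emit_num\<close> adds the offset of the copy together with the terminator.\<close>

definition emit_var :: "nat \<Rightarrow> prog" where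
  "emit_var k = emit_num 2 ;;
     (if k mod 3 = 0 then emit_copy False (k div 3) ;; Emit False
      else emit_copy False 1 ;; emit_copy True (k div 3) ;; emit_num (k mod 3 - 1))"

fun emit_formula :: "formula \<Rightarrow> prog" where
  "emit_formula (FConst b) = emit_num (of_bool b)"
| "emit_formula (FVar k) = emit_var k"
| "emit_formula (FNot \<phi>) = emit_formula \<phi> ;; emit_num 3"
| "emit_formula (FAnd \<phi> \<psi>) = emit_formula \<phi> ;; emit_formula \<psi> ;; emit_num 4"
| "emit_formula (FOr \<phi> \<psi>) = emit_formula \<phi> ;; emit_formula \<psi> ;; emit_num 5"

text \<open>Two copies at \<open>10 * M + 2\<close> each, plus 3 for the token 2 and at most 2 for
  offset and terminator.\<close>

definition var_time :: "nat \<Rightarrow> nat" where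
  "var_time M = 20 * M + 9"

definition holds_number :: "(nat \<Rightarrow> bool list) \<Rightarrow> nat \<Rightarrow> nat \<Rightarrow> bool" where
  "holds_number s M r \<longleftrightarrow> r \<noteq> 2 \<and> s r = ones (length (s r)) \<and> length (s r) \<le> M"

lemma runs_emit_var:
  assumes "s 2 = []" "holds_number s M 1" "holds_number s M (k div 3)"
  shows "runs (emit_var k) (s, w) (var_time M) (s, w @ encode_nats [2, var_index s k])"
proof -
  have 1: "runs (emit_copy False 1) (s, w') (10 * M + 2) (s, w' @ ones (length (s 1)))" for w'
    using assms by (intro runs_conv[OF runs_emit_copy[where k = "length (s 1)"]]) (auto simp: holds_number_def)
  have 2: "runs (emit_copy d (k div 3)) (s, w') (10 * M + 2)
      (s, w' @ ones ((if d then 2 else 1) * length (s (k div 3))))" for w' d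
    using assms by (intro runs_conv[OF runs_emit_copy[where k = "length (s (k div 3))"]]) (auto simp: holds_number_def)
  show ?thesis
  proof (cases "k mod 3 = 0")
    case True
    then show ?thesis unfolding emit_var_def
      by (auto intro!: runs_conv[OF runs_Seq[OF runs_emit_num runs_Seq[OF 2 runs_Emit]]]
          simp: var_index_def var_time_def)
  next
    case False
    define e where "e = k mod 3 - 1"
    have "k mod 3 < 3" by simp
    then have "e \<le> 1" unfolding e_def by linarith
    then have "runs (emit_num 2 ;; emit_copy False 1 ;; emit_copy True (k div 3) ;; emit_num e) (s, w) (var_time M)
        (s, w @ encode_nats [2, length (s 1) + 2 * length (s (k div 3)) + e])"
      by (intro runs_conv[OF runs_Seq[OF runs_emit_num runs_Seq[OF 1 runs_Seq[OF 2 runs_emit_num]]]])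
        (simp_all add: var_time_def replicate_add)
    then show ?thesis
      unfolding emit_var_def var_index_def e_def[symmetric] using False by simp
  qed
qed

lemma runs_emit_formula:
  assumes "s 2 = []" "holds_number s M 1" "\<forall>k \<in> formula_vars \<phi>. holds_number s M (k div 3)"
  shows "runs (emit_formula \<phi>) (s, w) (length (formula_tokens \<phi>) * var_time M)
    (s, w @ encode_nats (formula_tokens (rename (var_index s) \<phi>)))"
  using assms(3)
proof (induction \<phi> arbitrary: w)
  case (FConst b)
  show ?case unfolding emit_formula.simps
    by (rule runs_conv[OF runs_emit_num]) (auto simp: var_time_def)
next
  case (FVar k)
  have "runs (emit_var k) (s, w) (var_time M) (s, w @ encode_nats [2, var_index s k])"
    using FVar by (intro runs_emit_var assms(1,2)) auto
  then show ?case unfolding emit_formula.simps by (rule runs_conv) auto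
next
  case (FNot \<phi>)
  have "\<forall>k \<in> formula_vars \<phi>. holds_number s M (k div 3)" using FNot.prems by auto
  note IH = FNot.IH[OF this]
  show ?case unfolding emit_formula.simps
    by (rule runs_conv[OF runs_Seq[OF IH runs_emit_num]]) (auto simp: var_time_def)
next
  case (FAnd \<phi> \<psi>)
  have "\<forall>k \<in> formula_vars \<phi>. holds_number s M (k div 3)" "\<forall>k \<in> formula_vars \<psi>. holds_number s M (k div 3)"
    using FAnd.prems by auto
  note IH = FAnd.IH(1)[OF this(1)] FAnd.IH(2)[OF this(2)]
  show ?case unfolding emit_formula.simps
    by (rule runs_conv[OF runs_Seq[OF IH(1) runs_Seq[OF IH(2) runs_emit_num]]])
      (auto simp: var_time_def algebra_simps)
next
  case (FOr \<phi> \<psi>)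
  have "\<forall>k \<in> formula_vars \<phi>. holds_number s M (k div 3)" "\<forall>k \<in> formula_vars \<psi>. holds_number s M (k div 3)"
    using FOr.prems by auto
  note IH = FOr.IH(1)[OF this(1)] FOr.IH(2)[OF this(2)]
  show ?case unfolding emit_formula.simps
    by (rule runs_conv[OF runs_Seq[OF IH(1) runs_Seq[OF IH(2) runs_emit_num]]])
      (auto simp: var_time_def algebra_simps)
qed

section \<open>The program for the dominance formula\<close>

definition clear :: "nat \<Rightarrow> prog" where
  "clear i = while_one i (Pop i)"

lemma runs_clear:
  assumes "s i = ones k"
  shows "runs (clear i) (s, w) (2 * k + 1) (s(i := []), w)"
proof -
  let ?S = "\<lambda>l. (s(i := ones (k - l)), w)"
  have *: "runs (Pop i) (?S l) 1 (?S (Suc l))" if "l < k" for l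
    by (rule runs_conv[OF runs_Pop]) (use that in auto)
  have "runs (clear i) (?S 0) (k * Suc 1 + 1) (?S k)"
    unfolding clear_def by (rule runs_while_one[where S = ?S and r = "[]", OF *]) auto
  moreover have "?S 0 = (s, w)" using assms by (auto simp: fun_eq_iff fun_upd_apply)
  ultimately show ?thesis by (simp add: mult_2_right mult_2)
qed

definition move_bit :: "nat \<Rightarrow> nat \<Rightarrow> prog" where
  "move_bit i j = IfTop i (\<lambda>a. a = 2) (Pop i ;; Push j True) (Pop i ;; Push j False)"

lemma runs_move_bit:
  assumes "s i = b # r" "i \<noteq> j"
  shows "runs (move_bit i j) (s, w) 4 (s(i := r, j := b # s j), w)"
proof -
  have "runs (Pop i ;; Push j b) (s, w) 3 (s(i := r, j := b # s j), w)"
    using assms by (intro runs_conv[OF runs_Seq[OF runs_Pop runs_Push]]) auto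
  then have "runs (move_bit i j) (s, w) (Suc 3) (s(i := r, j := b # s j), w)"
    unfolding move_bit_def using assms(1) by (intro runs_If) (cases b; simp)
  then show ?thesis by (rule runs_le) simp
qed

definition move_word :: "nat \<Rightarrow> nat \<Rightarrow> prog" where
  "move_word i j = while_nonempty i (move_bit i j)"

lemma runs_move_word:
  assumes "s i = xs" "i \<noteq> j"
  shows "runs (move_word i j) (s, w) (5 * length xs + 1) (s(i := [], j := rev xs @ s j), w)"
proof -
  let ?S = "\<lambda>l. (s(i := drop l xs, j := rev (take l xs) @ s j), w)"
  have drop: "drop l xs = xs ! l # drop (Suc l) xs" if "l < length xs" for l
    using that by (simp add: Cons_nth_drop_Suc)
  have "runs (move_word i j) (?S 0) (length xs * Suc 4 + 1) (?S (length xs))"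
    unfolding move_word_def
  proof (rule runs_While_iterate[where S = ?S])
    show "runs (move_bit i j) (?S l) 4 (?S (Suc l))" if "l < length xs" for l
      by (rule runs_conv[OF runs_move_bit[where b = "xs ! l" and r = "drop (Suc l) xs"]])
        (use drop[OF that] that assms(2) in \<open>auto simp: take_Suc_conv_app_nth fun_eq_iff fun_upd_apply\<close>)
  qed (use drop assms(2) in auto)
  moreover have "?S 0 = (s, w)" using assms by (auto simp: fun_eq_iff fun_upd_apply)
  ultimately show ?thesis by (simp add: mult.commute)
qed

definition direct :: "nat \<Rightarrow> nat" where
  "direct r = 3 * r"

text \<open>Register 5 is the gate's own wire, 6 and 7 hold its arguments. The number 5 printed
  afterwards is the \<open>FOr\<close> that joins the clash to the disjunction so far; 6 and 7 are
  emptied for the next \<open>read_num\<close>.\<close>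

definition gate_prog :: "gate \<Rightarrow> prog" where
  "gate_prog g = emit_formula (clash copy1 copy2 5 g) ;; emit_num 5 ;; Push 5 True ;; clear 6 ;; clear 7"

definition read_num :: "nat \<Rightarrow> prog" where
  "read_num i = move 0 i ;; Pop 0"

text \<open>The last alternative belongs to the end marker 5 and clears the flag in register 11 on
  which \<open>emit_gates\<close> loops.\<close>

definition gate_programs :: "prog list" where
  "gate_programs = [gate_prog (GConst False), gate_prog (GConst True), read_num 6 ;; gate_prog (GNot 6),
     read_num 6 ;; read_num 7 ;; gate_prog (GAnd 6 7), read_num 6 ;; read_num 7 ;; gate_prog (GOr 6 7), Pop 11]"

text \<open>\<open>N\<close> opens the output and enters every wire index, so it is counted before
  anything is parsed. Reading consumes the input, which is saved reversed in register 2 and moved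
  back.\<close>

definition count_input :: prog where
  "count_input =
     while_nonempty 0 (move_bit 0 2 ;; Push 1 True ;; Push 1 True ;; Push 3 True ;; Push 3 True ;; Emit True ;; Emit True) ;;
     Emit False ;; move_word 2 0"

definition read_inputs :: prog where
  "read_inputs = while_one 0 (Pop 0 ;; Pop 3 ;; Push 4 True ;; Push 8 True ;; Push 9 True ;; Push 10 True) ;; Pop 0"

definition emit_padding :: prog where
  "emit_padding = while_one 3 (emit_formula (FNot (FVar (direct 4))) ;; emit_num 4 ;; Push 4 True ;; Pop 3)"

definition emit_equation :: "nat \<Rightarrow> prog" where
  "emit_equation k = emit_formula (xor_formula (FVar (copy1 5)) (FVar k)) ;; emit_num 5 ;; Push 5 True"

definition emit_gates :: prog where
  "emit_gates = while_one 11 (dispatch 0 gate_programs)"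

definition emit_comparison :: prog where
  "emit_comparison = while_nonempty 0 (read_num 6 ;;
     emit_formula (FAnd (FVar (copy1 6)) (FNot (FVar (copy2 6)))) ;;
     emit_formula (FOr (FVar (copy1 6)) (FNot (FVar (copy2 6)))) ;; clear 6)"

text \<open>The single numbers are formula tokens: 1 and 0 start the padding conjunction and the
  disjunction of violations, the second 1 is the innermost \<open>FConst True\<close> of the
  comparison, and the final 5 and 4 are the outer \<open>FOr\<close> and
  \<open>FAnd\<close>.\<close>

definition dominance_prog :: prog where
  "dominance_prog = count_input ;; read_inputs ;; emit_num 1 ;; emit_padding ;; emit_num 0 ;;
     while_one 8 (emit_equation (direct 5) ;; Pop 8) ;; while_one 9 (emit_equation (copy2 5) ;; Pop 9) ;; Push 11 True ;; emit_gates ;; emit_comparison ;;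
     emit_num 1 ;; while_one 10 (emit_num 4 ;; emit_num 5 ;; Pop 10) ;; emit_num 5 ;; emit_num 4"

abbreviation encode_formulas :: "nat \<Rightarrow> formula list \<Rightarrow> bool list" where
  "encode_formulas k \<phi>s \<equiv> encode_nats (concat (map (\<lambda>\<phi>. formula_tokens \<phi> @ [k]) \<phi>s))"

text \<open>Dominated by a clash of a binary gate, which has 39 tokens:
  \<open>39 * var_time M\<close> is \<open>780 * M + 351\<close>; the rest covers reading the
  arguments, clearing and dispatch.\<close>

definition block_time :: "nat \<Rightarrow> nat" where
  "block_time M = 800 * M + 500"

lemma rename_clash: "rename \<sigma> (clash u v a g) = clash (\<sigma> \<circ> u) (\<sigma> \<circ> v) a g"
  by (cases g) (simp_all add: clash_def xor_formula_def)

lemma var_index_copy [simp]: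
  "var_index s (copy1 r) = wire1 (length (s 1)) (length (s r))"
  "var_index s (copy2 r) = wire2 (length (s 1)) (length (s r))"
  "var_index s (direct r) = length (s r)"
proof -
  have "(3 * r + 2) mod 3 = 2" "(3 * r + 2) div 3 = r" "(3 * r + 1) mod 3 = 1" "(3 * r + 1) div 3 = r"
    by presburger+
  then show "var_index s (copy1 r) = wire1 (length (s 1)) (length (s r))"
    "var_index s (copy2 r) = wire2 (length (s 1)) (length (s r))"
    "var_index s (direct r) = length (s r)"
    by (simp_all add: var_index_def direct_def copy1_def copy2_def wire1_def wire2_def)
qed

lemma copy_div [simp]: "direct r div 3 = r" "copy1 r div 3 = r" "copy2 r div 3 = r"
  unfolding direct_def copy1_def copy2_def by presburger+

text \<open>Here \<open>g\<close> is a template whose arguments name registers, and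
  \<open>g'\<close> is the actual gate. The last assumption, that instantiation turns one into the
  other, lets all kinds of gates share this proof.\<close>

lemma runs_gate_prog:
  assumes "N \<le> M" "A \<le> M" "I \<le> M" "J \<le> M" "gate_wires g \<subseteq> {6, 7}"
    and "rename (var_index (dom_store N inp R B A I J a b c F)) (clash copy1 copy2 5 g) =
      clash (wire1 N) (wire2 N) A g'"
  shows "runs (gate_prog g) (dom_store N inp R B A I J a b c F, w) (39 * var_time M + 4 * M + 10)
    (dom_store N inp R B (Suc A) 0 0 a b c F, w @ encode_formulas 5 [clash (wire1 N) (wire2 N) A g'])"
proof -
  let ?s = "dom_store N inp R B A I J a b c F"
  let ?\<phi> = "clash copy1 copy2 5 g"
  have "formula_vars ?\<phi> \<subseteq> {copy1 5, copy2 5} \<union> copy1 ` {6, 7} \<union> copy2 ` {6, 7}"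
    using assms(5) by (auto simp: clash_def xor_formula_def formula_vars_gate_formula)
  then have "\<forall>k \<in> formula_vars ?\<phi>. holds_number ?s M (k div 3)"
    using assms(2-4) by (fastforce simp: holds_number_def)
  then have *: "runs (emit_formula ?\<phi>) (?s, w) (length (formula_tokens ?\<phi>) * var_time M)
      (?s, w @ encode_nats (formula_tokens (rename (var_index ?s) ?\<phi>)))"
    using assms(1) by (intro runs_emit_formula) (auto simp: holds_number_def)
  have "length (formula_tokens ?\<phi>) \<le> 39"
    by (cases g) (simp_all add: clash_def xor_formula_def)
  with * have 1: "runs (emit_formula ?\<phi>) (?s, w) (39 * var_time M)
      (?s, w @ encode_nats (formula_tokens (clash (wire1 N) (wire2 N) A g')))"
    unfolding assms(6) by (intro runs_le[OF *[unfolded assms(6)]] mult_le_mono1)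
  have 2: "runs (clear 6) (dom_store N inp R B (Suc A) I J a b c F, w') (2 * M + 1)
      (dom_store N inp R B (Suc A) 0 J a b c F, w')" for w'
    by (rule runs_conv[OF runs_clear[where k = I]]) (use assms(3) in auto)
  have 3: "runs (clear 7) (dom_store N inp R B (Suc A) 0 J a b c F, w') (2 * M + 1)
      (dom_store N inp R B (Suc A) 0 0 a b c F, w')" for w'
    by (rule runs_conv[OF runs_clear[where k = J]]) (use assms(4) in auto)
  have 4: "runs (Push 5 True) (?s, w') 2 (dom_store N inp R B (Suc A) I J a b c F, w')" for w'
    by (rule runs_conv[OF runs_Push]) auto
  show ?thesis
    unfolding gate_prog_def
    by (rule runs_conv[OF runs_Seq[OF 1 runs_Seq[OF runs_emit_num runs_Seq[OF 4 runs_Seq[OF 2 3]]]]]) simp_all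
qed

lemma runs_read_num:
  assumes "k \<le> M"
  shows "runs (read_num 6) (dom_store N (encode_nats [k] @ inp) R B A 0 J a b c F, w) (4 * M + 2)
      (dom_store N inp R B A k J a b c F, w)"
    "runs (read_num 7) (dom_store N (encode_nats [k] @ inp) R B A I 0 a b c F, w) (4 * M + 2)
      (dom_store N inp R B A I k a b c F, w)"
  unfolding read_num_def
  by (rule runs_conv[OF runs_Seq[OF runs_move[where k = k and r = "False # inp"] runs_Pop]]; use assms in simp)+

lemma runs_gate_step:
  assumes "N \<le> M" "A \<le> M" "\<And>i. i \<in> gate_wires g \<Longrightarrow> i \<le> M"
  shows "runs (dispatch 0 gate_programs) (dom_store N (encode_nats (gate_tokens g) @ inp) R B A 0 0 a b c F, w)
    (block_time M) (dom_store N inp R B (Suc A) 0 0 a b c F,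
      w @ encode_formulas 5 [clash (wire1 N) (wire2 N) A g])"
proof -
  let ?s = "\<lambda>inp. dom_store N inp R B A 0 0 a b c F"
  let ?S = "(dom_store N inp R B (Suc A) 0 0 a b c F, w @ encode_formulas 5 [clash (wire1 N) (wire2 N) A g])"
  have dispatch: "runs (dispatch 0 gate_programs) (?s (encode_nats [k] @ inp'), w) (block_time M) ?S"
    if "runs p (?s inp', w) t ?S" "k < 6" "gate_programs ! k = p" "t + 12 \<le> block_time M" for k p t inp'
    by (rule runs_le[OF runs_dispatch[where k = k and r = inp']])
      (use that in \<open>auto simp: gate_programs_def\<close>)
  note gate = runs_gate_prog[OF assms(1,2)]
  show ?thesis
  proof (cases g)
    case (GConst d)
    have "runs (gate_prog (GConst d)) (?s inp, w) (39 * var_time M + 4 * M + 10) ?S"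
      unfolding GConst by (rule gate) (simp_all add: rename_clash clash_def xor_formula_def)
    from dispatch[OF this, of "of_bool d"] show ?thesis
      by (simp add: GConst gate_programs_def var_time_def block_time_def)
  next
    case (GNot i)
    have i: "i \<le> M" using assms(3) GNot by simp
    have "runs (gate_prog (GNot 6)) (dom_store N inp R B A i 0 a b c F, w) (39 * var_time M + 4 * M + 10) ?S"
      unfolding GNot by (rule gate[OF i]) (simp_all add: rename_clash clash_def xor_formula_def)
    from dispatch[OF runs_Seq[OF runs_read_num(1)[OF i] this], of 2] show ?thesis
      by (simp add: GNot gate_programs_def var_time_def block_time_def)
  next
    case (GAnd i j)
    have ij: "i \<le> M" "j \<le> M" using assms(3) GAnd by simp_all
    have "runs (gate_prog (GAnd 6 7)) (dom_store N inp R B A i j a b c F, w) (39 * var_time M + 4 * M + 10) ?S"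
      unfolding GAnd by (rule gate[OF ij]) (simp_all add: rename_clash clash_def xor_formula_def)
    from dispatch[OF runs_Seq[OF runs_read_num(1)[OF ij(1)] runs_Seq[OF runs_read_num(2)[OF ij(2)] this]], of 3]
    show ?thesis
      by (simp add: GAnd gate_programs_def var_time_def block_time_def)
  next
    case (GOr i j)
    have ij: "i \<le> M" "j \<le> M" using assms(3) GOr by simp_all
    have "runs (gate_prog (GOr 6 7)) (dom_store N inp R B A i j a b c F, w) (39 * var_time M + 4 * M + 10) ?S"
      unfolding GOr by (rule gate[OF ij]) (simp_all add: rename_clash clash_def xor_formula_def)
    from dispatch[OF runs_Seq[OF runs_read_num(1)[OF ij(1)] runs_Seq[OF runs_read_num(2)[OF ij(2)] this]], of 4]
    show ?thesis
      by (simp add: GOr gate_programs_def var_time_def block_time_def)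
  qed
qed

lemma runs_emit_gates:
  assumes "N \<le> M" "A + length gs \<le> M" "\<And>g i. g \<in> set gs \<Longrightarrow> i \<in> gate_wires g \<Longrightarrow> i \<le> M"
  shows "runs emit_gates
    (dom_store N (encode_nats (concat (map gate_tokens gs)) @ encode_nats [5] @ inp) R B A 0 0 a b c 1, w)
    (length gs * Suc (block_time M) + 15)
    (dom_store N inp R B (A + length gs) 0 0 a b c 0,
      w @ encode_formulas 5 (clashes (wire1 N) (wire2 N) A gs))"
  using assms
proof (induction gs arbitrary: A w)
  case Nil
  have "runs (Pop 11) (dom_store N inp R B A 0 0 a b c 1, w) 1 (dom_store N inp R B A 0 0 a b c 0, w)"
    by (rule runs_conv[OF runs_Pop]) auto
  then have "runs (dispatch 0 gate_programs) (dom_store N (encode_nats [5] @ inp) R B A 0 0 a b c 1, w)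
      (1 + 2 * 5 + 2) (dom_store N inp R B A 0 0 a b c 0, w)"
    by (intro runs_dispatch[where r = inp]) (simp_all add: gate_programs_def)
  then have "runs emit_gates (dom_store N (encode_nats [5] @ inp) R B A 0 0 a b c 1, w)
      (Suc (1 + 2 * 5 + 2) + 1) (dom_store N inp R B A 0 0 a b c 0, w)"
    unfolding emit_gates_def by (rule runs_While_step[OF _ _ runs_While_end, rotated]) simp_all
  then show ?case by (simp del: encode_nats_simps(2))
next
  case (Cons g gs)
  let ?inp = "encode_nats (concat (map gate_tokens gs)) @ encode_nats [5] @ inp"
  have 1: "runs (dispatch 0 gate_programs) (dom_store N (encode_nats (gate_tokens g) @ ?inp) R B A 0 0 a b c 1, w)
      (block_time M) (dom_store N ?inp R B (Suc A) 0 0 a b c 1,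
        w @ encode_formulas 5 [clash (wire1 N) (wire2 N) A g])"
    using Cons.prems by (intro runs_gate_step) auto
  have 2: "runs emit_gates (dom_store N ?inp R B (Suc A) 0 0 a b c 1,
        w @ encode_formulas 5 [clash (wire1 N) (wire2 N) A g]) (length gs * Suc (block_time M) + 15)
      (dom_store N inp R B (Suc A + length gs) 0 0 a b c 0,
        (w @ encode_formulas 5 [clash (wire1 N) (wire2 N) A g]) @
        encode_formulas 5 (clashes (wire1 N) (wire2 N) (Suc A) gs))"
    using Cons.prems by (intro Cons.IH) auto
  have "runs emit_gates (dom_store N (encode_nats (gate_tokens g) @ ?inp) R B A 0 0 a b c 1, w)
      (Suc (block_time M) + (length gs * Suc (block_time M) + 15))
      (dom_store N inp R B (Suc A + length gs) 0 0 a b c 0,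
        (w @ encode_formulas 5 [clash (wire1 N) (wire2 N) A g]) @
        encode_formulas 5 (clashes (wire1 N) (wire2 N) (Suc A) gs))"
    using 1 2 unfolding emit_gates_def by (intro runs_While_step) simp_all
  then show ?case by (simp add: add.left_commute)
qed

lemma runs_emit_comparison:
  assumes "N \<le> M" "\<And>i. i \<in> set is \<Longrightarrow> i \<le> M"
  shows "runs emit_comparison (dom_store N (encode_nats is) R B A 0 J a b c F, w)
    (length is * Suc (block_time M) + 1)
    (dom_store N [] R B A 0 J a b c F, w @ encode_nats (concat (map (\<lambda>i.
      formula_tokens (FAnd (FVar (wire1 N i)) (FNot (FVar (wire2 N i)))) @
      formula_tokens (FOr (FVar (wire1 N i)) (FNot (FVar (wire2 N i))))) is)))"
  using assms
proof (induction "is" arbitrary: w)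
  case Nil
  show ?case unfolding emit_comparison_def by (rule runs_conv[OF runs_While_end]) simp_all
next
  case (Cons i "is")
  let ?s = "dom_store N (encode_nats is) R B A i J a b c F"
  have i: "i \<le> M" using Cons.prems by simp
  have holds: "holds_number ?s M 1" "holds_number ?s M 6"
    using Cons.prems by (simp_all add: holds_number_def)
  have emit: "runs (emit_formula \<phi>) (?s, w') (6 * var_time M)
      (?s, w' @ encode_nats (formula_tokens (rename (var_index ?s) \<phi>)))"
    if "formula_vars \<phi> = {copy1 6, copy2 6}" "length (formula_tokens \<phi>) = 6" for \<phi> w'
    using holds that by (intro runs_conv[OF runs_emit_formula[where M = M]]) auto
  have clear: "runs (clear 6) (?s, w') (2 * M + 1) (dom_store N (encode_nats is) R B A 0 J a b c F, w')" for w'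
    by (rule runs_conv[OF runs_clear[where k = i]]) (use i in auto)
  let ?v = "w @ encode_nats (formula_tokens (FAnd (FVar (wire1 N i)) (FNot (FVar (wire2 N i)))) @
      formula_tokens (FOr (FVar (wire1 N i)) (FNot (FVar (wire2 N i)))))"
  have 1: "runs (read_num 6 ;; emit_formula (FAnd (FVar (copy1 6)) (FNot (FVar (copy2 6)))) ;;
      emit_formula (FOr (FVar (copy1 6)) (FNot (FVar (copy2 6)))) ;; clear 6)
      (dom_store N (encode_nats [i] @ encode_nats is) R B A 0 J a b c F, w) (block_time M)
      (dom_store N (encode_nats is) R B A 0 J a b c F, ?v)"
    by (rule runs_conv[OF runs_Seq[OF runs_read_num(1)[OF i] runs_Seq[OF emit runs_Seq[OF emit clear]]]])
      (auto simp: block_time_def var_time_def)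
  have 2: "runs emit_comparison (dom_store N (encode_nats is) R B A 0 J a b c F, ?v)
      (length is * Suc (block_time M) + 1) (dom_store N [] R B A 0 J a b c F, ?v @ encode_nats (concat (map (\<lambda>i.
      formula_tokens (FAnd (FVar (wire1 N i)) (FNot (FVar (wire2 N i)))) @
      formula_tokens (FOr (FVar (wire1 N i)) (FNot (FVar (wire2 N i))))) is)))"
    using Cons.prems by (intro Cons.IH) auto
  have "top_symbol (encode_nats [i] @ encode_nats is) \<noteq> 0"
    by (cases i) auto
  then have "runs emit_comparison (dom_store N (encode_nats [i] @ encode_nats is) R B A 0 J a b c F, w)
      (Suc (block_time M) + (length is * Suc (block_time M) + 1)) (dom_store N [] R B A 0 J a b c F,
        ?v @ encode_nats (concat (map (\<lambda>i.
      formula_tokens (FAnd (FVar (wire1 N i)) (FNot (FVar (wire2 N i)))) @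
      formula_tokens (FOr (FVar (wire1 N i)) (FNot (FVar (wire2 N i))))) is)))"
    using 1 2 unfolding emit_comparison_def by (intro runs_While_step) simp_all
  then show ?case by (simp add: add.left_commute)
qed

lemma runs_count_input:
  "runs count_input ((\<lambda>_. [])(0 := v), []) (20 * length v + 3)
    (dom_store (2 * length v) v (2 * length v) 0 0 0 0 0 0 0 0, encode_nats [2 * length v])"
proof -
  let ?body = "move_bit 0 2 ;; Push 1 True ;; Push 1 True ;; Push 3 True ;; Push 3 True ;; Emit True ;; Emit True"
  let ?s = "\<lambda>l. (\<lambda>_ :: nat. [])(0 := drop l v, 1 := ones (2 * l), 2 := rev (take l v), 3 := ones (2 * l))"
  let ?S = "\<lambda>l. (?s l, ones (2 * l))"
  have drop: "drop l v = v ! l # drop (Suc l) v" if "l < length v" for l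
    using that by (simp add: Cons_nth_drop_Suc)
  have "runs (while_nonempty 0 ?body) (?S 0) (length v * Suc 14 + 1) (?S (length v))"
  proof (rule runs_While_iterate[where S = ?S])
    fix l assume l: "l < length v"
    show "top_symbol (fst (?S l) 0) \<noteq> 0" using drop[OF l] by simp
    have 1: "runs (move_bit 0 2) (?S l) 4 ((?s l)(0 := drop (Suc l) v, 2 := rev (take (Suc l) v)), ones (2 * l))"
      by (rule runs_conv[OF runs_move_bit[where b = "v ! l" and r = "drop (Suc l) v"]])
        (use drop[OF l] l in \<open>auto simp: take_Suc_conv_app_nth\<close>)
    show "runs ?body (?S l) 14 (?S (Suc l))"
      by (rule runs_conv[OF runs_Seq[OF 1 runs_Seq[OF runs_Push runs_Seq[OF runs_Push runs_Seq[OF runs_Push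
            runs_Seq[OF runs_Push runs_Seq[OF runs_Emit runs_Emit]]]]]]])
        (auto simp: fun_eq_iff fun_upd_apply ones_snoc)
  qed simp
  moreover have "?S 0 = ((\<lambda>_. [])(0 := v), [])"
    by (auto simp: fun_eq_iff fun_upd_apply)
  ultimately have 1: "runs (while_nonempty 0 ?body) ((\<lambda>_. [])(0 := v), []) (15 * length v + 1) (?S (length v))"
    by (simp add: mult.commute)
  have 2: "runs (move_word 2 0) (?s (length v), w) (5 * length v + 1)
      (dom_store (2 * length v) v (2 * length v) 0 0 0 0 0 0 0 0, w)" for w
    by (rule runs_conv[OF runs_move_word[where xs = "rev v"]])
      (auto simp: dom_store_def fun_eq_iff fun_upd_apply)
  show ?thesis
    unfolding count_input_def
    by (rule runs_conv[OF runs_Seq[OF 1 runs_Seq[OF runs_Emit 2]]]) simp_all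
qed

lemma runs_read_inputs:
  assumes "n \<le> R"
  shows "runs read_inputs (dom_store N (encode_nats [n] @ inp) R 0 0 0 0 0 0 0 0, w) (11 * n + 2)
    (dom_store N inp (R - n) n 0 0 0 n n n 0, w)"
proof -
  let ?body = "Pop 0 ;; Pop 3 ;; Push 4 True ;; Push 8 True ;; Push 9 True ;; Push 10 True"
  let ?S = "\<lambda>j. (dom_store N (ones (n - j) @ False # inp) (R - j) j 0 0 0 j j j 0, w)"
  have *: "runs ?body (?S j) 10 (?S (Suc j))" if "j < n" for j
  proof -
    have "n - j = Suc (n - Suc j)" using that by simp
    then show ?thesis
      by (intro runs_conv[OF runs_Seq[OF runs_Pop runs_Seq[OF runs_Pop runs_Seq[OF runs_Push
          runs_Seq[OF runs_Push runs_Seq[OF runs_Push runs_Push]]]]]]) auto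
  qed
  have "runs (while_one 0 ?body) (?S 0) (n * Suc 10 + 1) (?S n)"
    by (rule runs_while_one[where S = ?S and r = "False # inp", OF *]) auto
  from runs_Seq[OF this runs_Pop[of 0]] show ?thesis
    unfolding read_inputs_def by (simp add: mult.commute)
qed

lemma runs_emit_padding:
  assumes "N \<le> M" "B + R \<le> M"
  shows "runs emit_padding (dom_store N inp R B A I J a b c F, w) (R * Suc (block_time M) + 1)
    (dom_store N inp 0 (B + R) A I J a b c F, w @ encode_formulas 4 (map (\<lambda>i. FNot (FVar i)) [B..<B + R]))"
proof -
  let ?S = "\<lambda>j. (dom_store N inp (R - j) (B + j) A I J a b c F,
    w @ encode_formulas 4 (map (\<lambda>i. FNot (FVar i)) [B..<B + j]))"
  have *: "runs (emit_formula (FNot (FVar (direct 4))) ;; emit_num 4 ;; Push 4 True ;; Pop 3) (?S j) (block_time M) (?S (Suc j))"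
    if "j < R" for j
  proof -
    let ?s = "dom_store N inp (R - j) (B + j) A I J a b c F"
    have "holds_number ?s M 1" "holds_number ?s M 4"
      using assms that by (simp_all add: holds_number_def)
    then have "runs (emit_formula (FNot (FVar (direct 4)))) (?s, w') (3 * var_time M)
        (?s, w' @ encode_nats (formula_tokens (FNot (FVar (B + j)))))" for w'
      by (intro runs_conv[OF runs_emit_formula[where M = M]]) (auto)
    from runs_Seq[OF this runs_Seq[OF runs_emit_num runs_Seq[OF runs_Push runs_Pop]]] show ?thesis
      by (rule runs_conv) (use that in \<open>auto simp: block_time_def var_time_def Suc_diff_Suc\<close>)
  qed
  have "runs emit_padding (?S 0) (R * Suc (block_time M) + 1) (?S R)"
    unfolding emit_padding_def by (rule runs_while_one[where S = ?S and r = "[]", OF *]) auto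
  then show ?thesis by simp
qed

lemma runs_emit_equation:
  assumes "N \<le> M" "A \<le> M" "k div 3 = 5"
  shows "runs (emit_equation k)
    (dom_store N inp R B A I J a b c F, w) (13 * var_time M + 8)
    (dom_store N inp R B (Suc A) I J a b c F, w @ encode_formulas 5
      [xor_formula (FVar (wire1 N A)) (FVar (var_index (dom_store N inp R B A I J a b c F) k))])"
proof -
  let ?s = "dom_store N inp R B A I J a b c F"
  have "holds_number ?s M 1" "holds_number ?s M 5"
    using assms by (simp_all add: holds_number_def)
  then have "runs (emit_formula (xor_formula (FVar (copy1 5)) (FVar k))) (?s, w) (13 * var_time M)
      (?s, w @ encode_nats (formula_tokens (xor_formula (FVar (wire1 N A)) (FVar (var_index ?s k)))))"
    using assms(3) by (intro runs_conv[OF runs_emit_formula[where M = M]]) (auto simp: xor_formula_def)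
  from runs_Seq[OF this runs_Seq[OF runs_emit_num runs_Push]] show ?thesis
    unfolding emit_equation_def by (rule runs_conv) auto
qed

lemma runs_strategy_equations:
  assumes "N \<le> M" "A + a \<le> M"
  shows "runs (while_one 8 (emit_equation (direct 5) ;; Pop 8)) (dom_store N inp R B A I J a b c F, w)
    (a * Suc (block_time M) + 1) (dom_store N inp R B (A + a) I J 0 b c F,
      w @ encode_formulas 5 (map (\<lambda>i. xor_formula (FVar (wire1 N i)) (FVar i)) [A..<A + a]))"
proof -
  let ?S = "\<lambda>j. (dom_store N inp R B (A + j) I J (a - j) b c F,
    w @ encode_formulas 5 (map (\<lambda>i. xor_formula (FVar (wire1 N i)) (FVar i)) [A..<A + j]))"
  have *: "runs (emit_equation (direct 5) ;; Pop 8) (?S j) (block_time M) (?S (Suc j))" if "j < a" for j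
    by (rule runs_conv[OF runs_Seq[OF runs_emit_equation[where M = M] runs_Pop]])
      (use assms that in \<open>auto simp: block_time_def var_time_def\<close>)
  have "runs (while_one 8 (emit_equation (direct 5) ;; Pop 8)) (?S 0) (a * Suc (block_time M) + 1) (?S a)"
    by (rule runs_while_one[where S = ?S and r = "[]", OF *]) auto
  then show ?thesis by simp
qed

lemma runs_opponent_equations:
  assumes "N \<le> M" "A + b \<le> M"
  shows "runs (while_one 9 (emit_equation (copy2 5) ;; Pop 9)) (dom_store N inp R B A I J a b c F, w)
    (b * Suc (block_time M) + 1) (dom_store N inp R B (A + b) I J a 0 c F,
      w @ encode_formulas 5 (map (\<lambda>i. xor_formula (FVar (wire1 N i)) (FVar (wire2 N i))) [A..<A + b]))"
proof -
  let ?S = "\<lambda>j. (dom_store N inp R B (A + j) I J a (b - j) c F,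
    w @ encode_formulas 5 (map (\<lambda>i. xor_formula (FVar (wire1 N i)) (FVar (wire2 N i))) [A..<A + j]))"
  have *: "runs (emit_equation (copy2 5) ;; Pop 9) (?S j) (block_time M) (?S (Suc j))" if "j < b" for j
    by (rule runs_conv[OF runs_Seq[OF runs_emit_equation[where M = M] runs_Pop]])
      (use assms that in \<open>auto simp: block_time_def var_time_def\<close>)
  have "runs (while_one 9 (emit_equation (copy2 5) ;; Pop 9)) (?S 0) (b * Suc (block_time M) + 1) (?S b)"
    by (rule runs_while_one[where S = ?S and r = "[]", OF *]) auto
  then show ?thesis by simp
qed

section \<open>Token sequences and the complete run\<close>

lemma formula_tokens_foldl_FOr:
  "formula_tokens (foldl FOr \<phi> \<phi>s) = formula_tokens \<phi> @ concat (map (\<lambda>\<phi>. formula_tokens \<phi> @ [5]) \<phi>s)"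
  by (induction \<phi>s arbitrary: \<phi>) auto

lemma formula_tokens_padding:
  "formula_tokens (foldl (\<lambda>\<phi> i. FAnd \<phi> (FNot (FVar i))) \<phi> is) =
    formula_tokens \<phi> @ concat (map (\<lambda>\<phi>. formula_tokens \<phi> @ [4]) (map (\<lambda>i. FNot (FVar i)) is))"
  by (induction "is" arbitrary: \<phi>) auto

lemma concat_replicate_append: "concat (replicate k xs) @ xs = xs @ concat (replicate k xs)"
  by (induction k) auto

text \<open>Right nesting defers the operators to the end, where they form equal pairs 4, 5; a
  counter of the outputs therefore suffices to print them.\<close>

lemma formula_tokens_ge:
  "formula_tokens (ge_formula u v is) =
    concat (map (\<lambda>i. formula_tokens (FAnd (FVar (u i)) (FNot (FVar (v i)))) @
      formula_tokens (FOr (FVar (u i)) (FNot (FVar (v i))))) is) @ [1] @ concat (replicate (length is) [4, 5])"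
proof (induction "is")
  case (Cons i "is")
  then show ?case using concat_replicate_append[of _ "[4, 5]"] by simp
qed simp

lemma runs_close:
  "runs (while_one 10 (emit_num 4 ;; emit_num 5 ;; Pop 10)) (dom_store N inp R B A I J a b c F, w) (13 * c + 1)
    (dom_store N inp R B A I J a b 0 F, w @ encode_nats (concat (replicate c [4, 5])))"
proof -
  let ?S = "\<lambda>j. (dom_store N inp R B A I J a b (c - j) F, w @ encode_nats (concat (replicate j [4, 5])))"
  have *: "runs (emit_num 4 ;; emit_num 5 ;; Pop 10) (?S j) 12 (?S (Suc j))" if "j < c" for j
    using arg_cong[OF concat_replicate_append[of j "[4, 5]"], of encode_nats]
    by (intro runs_conv[OF runs_Seq[OF runs_emit_num runs_Seq[OF runs_emit_num runs_Pop]]]) simp_all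
  have "runs (while_one 10 (emit_num 4 ;; emit_num 5 ;; Pop 10)) (?S 0) (c * Suc 12 + 1) (?S c)"
    by (rule runs_while_one[where S = ?S and r = "[]", OF *]) auto
  then show ?thesis by (simp add: mult.commute)
qed

lemma length_encode_gates: "length gs \<le> length (encode_gates gs)"
proof (induction gs)
  case (Cons g gs)
  have "encode_nats (gate_tokens g) \<noteq> []"
    by (cases g) simp_all
  then show ?case using Cons by (cases "encode_nats (gate_tokens g)") simp_all
qed simp

text \<open>The unary \<open>n\<close> and the \<open>n\<close> outputs contribute at least
  \<open>n\<close> bits each, and every gate at least one. Twice the input length thus accommodates
  both copies of the wires.\<close>

lemma encode_WDom_length:
  assumes "is_circuit (2 * n) n C"
  shows "2 * n + length (gates C) \<le> length (encode_nats (n # circuit_tokens C))"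
proof -
  have "length (outputs C) = n" using assms by (simp add: is_circuit_def)
  then have "n \<le> length (encode_nats (outputs C))" by (simp add: length_encode_nats)
  then show ?thesis using length_encode_gates[of "gates C"] by (simp add: circuit_tokens_def)
qed

lemma runs_dominance_prog:
  assumes "is_circuit (2 * n) n C"
  defines "v \<equiv> encode_nats (n # circuit_tokens C)"
  defines "N \<equiv> 2 * length v"
  shows "\<exists>s. runs dominance_prog ((\<lambda>_. [])(0 := v), []) (2 * N * Suc (block_time N) + 34 * N + 45)
    (s, encode_nats (N # formula_tokens (dominance_formula N n C)))"
proof -
  define G where "G = length (gates C)"
  define T where "T = Suc (block_time N)"
  have outs: "length (outputs C) = n" using assms(1) by (simp add: is_circuit_def)
  have N: "2 * (2 * n + G) \<le> N" using encode_WDom_length[OF assms(1)] by (simp add: N_def v_def G_def)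
  have gate_le: "i \<le> N" if "g \<in> set (gates C)" "i \<in> gate_wires g" for g i
  proof -
    obtain j where "j < G" "gates C ! j = g" using \<open>g \<in> set (gates C)\<close> by (auto simp: in_set_conv_nth G_def)
    then have "i < 2 * n + j" using assms(1) that(2) by (auto simp: is_circuit_def G_def)
    then show ?thesis using N \<open>j < G\<close> by simp
  qed
  have out_le: "i \<le> N" if "i \<in> set (outputs C)" for i
    using assms(1) that N by (fastforce simp: is_circuit_def G_def)
  define inp2 where "inp2 = encode_nats (outputs C)"
  define inp1 where "inp1 = encode_nats (concat (map gate_tokens (gates C))) @ encode_nats [5] @ inp2"
  have v: "v = encode_nats [n] @ inp1"
    by (simp add: v_def circuit_tokens_def inp1_def inp2_def)
  have 1: "runs count_input ((\<lambda>_. [])(0 := v), []) (10 * N + 3)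
      (dom_store N (encode_nats [n] @ inp1) N 0 0 0 0 0 0 0 0, encode_nats [N])"
    using runs_count_input[of v] unfolding N_def[symmetric] by (simp add: N_def v)
  have 2: "runs read_inputs (dom_store N (encode_nats [n] @ inp1) N 0 0 0 0 0 0 0 0, encode_nats [N]) (11 * n + 2)
      (dom_store N inp1 (N - n) n 0 0 0 n n n 0, encode_nats [N])"
    using N by (intro runs_read_inputs) simp
  have 3: "runs emit_padding (dom_store N inp1 (N - n) n 0 0 0 n n n 0, w) ((N - n) * T + 1)
      (dom_store N inp1 0 N 0 0 0 n n n 0, w @ encode_formulas 4 (map (\<lambda>i. FNot (FVar i)) [n..<N]))" for w
    using runs_emit_padding[of N N n "N - n"] N by (simp add: T_def)
  have 4: "runs (while_one 8 (emit_equation (direct 5) ;; Pop 8)) (dom_store N inp1 0 N 0 0 0 n n n 0, w) (n * T + 1)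
      (dom_store N inp1 0 N n 0 0 0 n n 0,
        w @ encode_formulas 5 (map (\<lambda>i. xor_formula (FVar (wire1 N i)) (FVar i)) [0..<n]))" for w
    using runs_strategy_equations[of N N 0 n] N by (simp add: T_def)
  have 5: "runs (while_one 9 (emit_equation (copy2 5) ;; Pop 9)) (dom_store N inp1 0 N n 0 0 0 n n 0, w) (n * T + 1)
      (dom_store N inp1 0 N (2 * n) 0 0 0 0 n 0,
        w @ encode_formulas 5 (map (\<lambda>i. xor_formula (FVar (wire1 N i)) (FVar (wire2 N i))) [n..<2 * n]))" for w
    using runs_opponent_equations[of N N n n] N by (simp add: T_def mult_2)
  have 6: "runs (Push 11 True) (dom_store N inp1 0 N (2 * n) 0 0 0 0 n 0, w) 2
      (dom_store N inp1 0 N (2 * n) 0 0 0 0 n 1, w)" for w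
    by (rule runs_conv[OF runs_Push]) simp_all
  have 7: "runs emit_gates (dom_store N inp1 0 N (2 * n) 0 0 0 0 n 1, w) (G * T + 15)
      (dom_store N inp2 0 N (2 * n + G) 0 0 0 0 n 0,
        w @ encode_formulas 5 (clashes (wire1 N) (wire2 N) (2 * n) (gates C)))" for w
    unfolding inp1_def G_def T_def by (rule runs_emit_gates) (use N gate_le in \<open>auto simp: G_def\<close>)
  have 8: "runs emit_comparison (dom_store N inp2 0 N (2 * n + G) 0 0 0 0 n 0, w) (n * T + 1)
      (dom_store N [] 0 N (2 * n + G) 0 0 0 0 n 0, w @ encode_nats (concat (map (\<lambda>i.
        formula_tokens (FAnd (FVar (wire1 N i)) (FNot (FVar (wire2 N i)))) @
        formula_tokens (FOr (FVar (wire1 N i)) (FNot (FVar (wire2 N i))))) (outputs C))))" for w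
    using runs_emit_comparison[of N N "outputs C"] out_le outs by (simp add: inp2_def T_def)
  note R = runs_Seq[OF 1 runs_Seq[OF 2 runs_Seq[OF runs_emit_num runs_Seq[OF 3 runs_Seq[OF runs_emit_num
    runs_Seq[OF 4 runs_Seq[OF 5 runs_Seq[OF 6 runs_Seq[OF 7 runs_Seq[OF 8 runs_Seq[OF runs_emit_num
    runs_Seq[OF runs_close runs_Seq[OF runs_emit_num runs_emit_num]]]]]]]]]]]]]
  have time: "10 * N + 3 + (11 * n + 2 + (Suc 1 + ((N - n) * T + 1 + (Suc 0 + (n * T + 1 + (n * T + 1 + (2 +
      (G * T + 15 + (n * T + 1 + (Suc 1 + (13 * n + 1 + (Suc 5 + Suc 4)))))))))))) \<le> 2 * N * T + 34 * N + 45"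
  proof -
    \<comment> \<open>Loop passes for padding, strategy bits, opponent bits, gates and outputs:
      together \<open>N + 2 * n + G\<close>, at most \<open>2 * N\<close>.\<close>
    have "(N - n) * T + n * T + n * T + G * T + n * T = (N - n + n + n + G + n) * T"
      by (simp add: algebra_simps)
    also have "\<dots> \<le> 2 * N * T"
      using N by (intro mult_le_mono1) simp
    finally have sum: "(N - n) * T + n * T + n * T + G * T + n * T \<le> 2 * N * T" .
    have "p + q + q + r + q \<le> z \<Longrightarrow> 10 * N + 3 + (11 * n + 2 + (Suc 1 + (p + 1 + (Suc 0 + (q + 1 + (q + 1 + (2 +
        (r + 15 + (q + 1 + (Suc 1 + (13 * n + 1 + (Suc 5 + Suc 4)))))))))))) \<le> z + 34 * N + 45" for p q r z
      using N by simp
    from this[OF sum] show ?thesis .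
  qed
  show ?thesis
    unfolding dominance_prog_def T_def[symmetric]
    by (rule exI, rule runs_conv[OF R _ time])
      (simp add: dominance_formula_def violations_def formula_tokens_foldl_FOr formula_tokens_padding
        formula_tokens_ge outs)
qed

theorem WDom_Strategy_reducible: "WDom_Strategy \<le>\<^sub>p UEA_Sat"
  unfolding poly_time_reducible_def
proof (intro exI conjI allI impI)
  let ?N = "\<lambda>a. 2 * length (encode WDom_Strategy a)"
  let ?f = "\<lambda>(n, C). (?N (n, C), dominance_formula (?N (n, C)) n C)"
  \<comment> \<open>For input length \<open>K\<close> the bound is
    \<open>6400 * K^2 + 2072 * K + 45\<close>, rounded up.\<close>
  let ?p = "[:45, 3000, 8000:] :: nat poly"
  show "tm_wf (compile dominance_prog)" by (rule tm_wf_compile)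
  fix a :: "nat \<times> circuit"
  assume inst: "is_instance WDom_Strategy a"
  obtain n C where a: "a = (n, C)" by (cases a)
  have C: "is_circuit (2 * n) n C" using inst by (simp add: a WDom_Strategy_def)
  have e: "encode WDom_Strategy a = encode_nats (n # circuit_tokens C)"
    "encode UEA_Sat (?f a) = encode_nats (?N a # formula_tokens (dominance_formula (?N a) n C))"
    by (simp_all add: a UEA_Sat_def WDom_Strategy_def)
  have N: "2 * (2 * n + length (gates C)) \<le> ?N a"
    using encode_WDom_length[OF C] unfolding e by simp
  show "is_instance UEA_Sat (?f a)" "is_yes WDom_Strategy a \<longleftrightarrow> is_yes UEA_Sat (?f a)"
    using is_instance_dominance[OF C N] is_yes_dominance[OF C N] by (simp_all add: a)
  have time: "2 * ?N a * Suc (block_time (?N a)) + 34 * ?N a + 45 \<le> poly ?p (length (encode WDom_Strategy a))"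
    by (simp add: block_time_def algebra_simps)
  obtain s where "runs dominance_prog ((\<lambda>_. [])(0 := encode WDom_Strategy a), [])
      (2 * ?N a * Suc (block_time (?N a)) + 34 * ?N a + 45) (s, encode UEA_Sat (?f a))"
    using runs_dominance_prog[OF C] unfolding e(2) e(1)[symmetric] by blast
  from runs_computes_within[OF runs_le[OF this time]]
  show "computes_within (compile dominance_prog) (encode WDom_Strategy a) (encode UEA_Sat (?f a))
      (poly ?p (length (encode WDom_Strategy a)))" .
qed

theorem theorem8p2:
  shows "poly_time_equivalent UEA_Sat WDom_Strategy"
  unfolding poly_time_equivalent_def
  using UEA_Sat_reducible WDom_Strategy_reducible by blast

end
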